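(* Let $G$ be a group. (1) Let $k\in\mathbb N_{\ge 2}$. We have $\mathcal U_k(G)=[\lambda_k(G),\rho_k(G)]$. Furthermore, if $G$ is infinite, then $\mathcal U_k(G)=\mathbb N_{\ge 2}$. (2) If $G$ has an element of infinite order or the orders of the abelian subgroups of $G$ are unbounded, then $\mathcal L(G)=\{L\subseteq\mathbb N_{\ge 2}: L\text{ finite and nonempty}\}\cup\{\{0\},\{1\}\}$ and hence $\Delta(G)=\mathbb N$.
   Context: $\mathbb N$ is the set of positive integers; $[a,b]=\{x\in\mathbb Z:a\le x\le b\}$ (with $[a,\infty]=\{x\in\mathbb Z:x\ge a\}$). $\mathcal F(G)$ is the free abelian monoid with basis $G$ (a multiplicative group). For $S=g_1\boldsymbol{\cdot}\ldots\boldsymbol{\cdot}g_\ell\in\mathcal F(G)$ let $\pi(S)=\{g_{\sigma(1)}\cdots g_{\sigma(\ell)}\in G:\sigma\text{ a permutation of }[1,\ell]\}$ (with $\pi=\{1_G\}$ for the empty sequence). $\mathcal B(G)=\{S\in\mathcal F(G):1_G\in\pi(S)\}$ is the monoid of product-one sequences over $G$; its only unit is the empty sequence. For $a\in\mathcal B(G)$, $\mathsf L(a)\subseteq\mathbb N_0$ is the set of all $n$ such that $a$ is a product of $n$ atoms (irreducible elements) of $\mathcal B(G)$, with $\mathsf L(1)=\{0\}$. $\mathcal L(G)=\{\mathsf L(a):a\in\mathcal B(G)\}$. For $L\subseteq\mathbb N_0$, $\Delta(L)$ is the set of $d\in\mathbb N$ for which there is $l\in L$ with $L\cap[l,l+d]=\{l,l+d\}$;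 $\Delta(G)=\bigcup_{L\in\mathcal L(G)}\Delta(L)$. For $k\in\mathbb N$, $\mathcal U_k(G)=\bigcup_{k\in L\in\mathcal L(G)}L$, $\rho_k(G)=\sup\mathcal U_k(G)$, $\lambda_k(G)=\min\mathcal U_k(G)$. *)

theory Defs
  imports
    "HOL-Algebra.Divisibility"
    "HOL-Algebra.Multiplicative_Group"
    "HOL-Combinatorics.Multiset_Permutations"
    "HOL-Library.Extended_Nat"
begin

text \<open>The predicate \<^const>\<open>factors\<close> does not ask the factors to lie in the carrier, so this is
  required separately. For the monoids below the empty list is the only factorization of the
  identity, whose set of lengths is therefore \<open>{0}\<close>.\<close>

definition set_of_lengths :: "('a, 'b) monoid_scheme \<Rightarrow> 'a \<Rightarrow> nat set" where
  "set_of_lengths H a = {length fs |fs. set fs \<subseteq> carrier H \<and> factors H fs a}"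

definition distances :: "nat set \<Rightarrow> nat set" where
  "distances L = {d. 1 \<le> d \<and> (\<exists>l\<in>L. L \<inter> {l..l + d} = {l, l + d})}"


definition sequence_monoid :: "('a, 'b) monoid_scheme \<Rightarrow> 'a multiset monoid" where
  "sequence_monoid G = \<lparr>carrier = {S. set_mset S \<subseteq> carrier G}, monoid.mult = (+), one = {#}\<rparr>"

definition products :: "('a, 'b) monoid_scheme \<Rightarrow> 'a multiset \<Rightarrow> 'a set" where
  "products G S = (\<lambda>gs. foldr (\<otimes>\<^bsub>G\<^esub>) gs \<one>\<^bsub>G\<^esub>) ` permutations_of_multiset S"

definition product_one_monoid :: "('a, 'b) monoid_scheme \<Rightarrow> 'a multiset monoid" where
  "product_one_monoid G = (sequence_monoid G)
     \<lparr>carrier := {S \<in> carrier (sequence_monoid G). \<one>\<^bsub>G\<^esub> \<in> products G S}\<rparr>"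

definition system_of_lengths :: "('a, 'b) monoid_scheme \<Rightarrow> nat set set" where
  "system_of_lengths G = set_of_lengths (product_one_monoid G) ` carrier (product_one_monoid G)"

definition set_of_distances :: "('a, 'b) monoid_scheme \<Rightarrow> nat set" where
  "set_of_distances G = (\<Union>L\<in>system_of_lengths G. distances L)"

definition union_of_lengths :: "('a, 'b) monoid_scheme \<Rightarrow> nat \<Rightarrow> nat set" where
  "union_of_lengths G k = \<Union>{L \<in> system_of_lengths G. k \<in> L}"

definition upper_elasticity :: "('a, 'b) monoid_scheme \<Rightarrow> nat \<Rightarrow> enat" where
  "upper_elasticity G k = (SUP n\<in>union_of_lengths G k. enat n)"

text \<open>On nonempty sets of natural numbers \<^const>\<open>Inf\<close> is the minimum, also for infinite sets, where
  \<^const>\<open>Min\<close> is unspecified.\<close>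

definition lower_elasticity :: "('a, 'b) monoid_scheme \<Rightarrow> nat \<Rightarrow> nat" where
  "lower_elasticity G k = Inf (union_of_lengths G k)"


text \<open>In the library, \<^term>\<open>group.ord G g = 0\<close> encodes that \<open>g\<close> has infinite order.\<close>

definition has_infinite_order_element :: "('a, 'b) monoid_scheme \<Rightarrow> bool" where
  "has_infinite_order_element G \<longleftrightarrow> (\<exists>g\<in>carrier G. group.ord G g = 0)"

text \<open>An infinite subgroup has order exceeding every bound, but \<^const>\<open>card\<close> is \<open>0\<close> on it.\<close>

definition unbounded_abelian_subgroups :: "('a, 'b) monoid_scheme \<Rightarrow> bool" where
  "unbounded_abelian_subgroups G \<longleftrightarrow>
     (\<forall>n::nat. \<exists>H. subgroup H G \<and> comm_group (G\<lparr>carrier := H\<rparr>) \<and> (infinite H \<or> n < card H))"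


lemma product_one_monoid_simps [simp]:
  "carrier (product_one_monoid G) = {S. set_mset S \<subseteq> carrier G \<and> \<one>\<^bsub>G\<^esub> \<in> products G S}"
  "S \<otimes>\<^bsub>product_one_monoid G\<^esub> T = S + T"
  "\<one>\<^bsub>product_one_monoid G\<^esub> = {#}"
  by (auto simp: product_one_monoid_def sequence_monoid_def)

lemma products_empty [simp]: "products G {#} = {\<one>\<^bsub>G\<^esub>}"
  by (simp add: products_def)

lemma (in group) foldr_mult_append:
  assumes "set xs \<subseteq> carrier G" "set ys \<subseteq> carrier G"
  shows "foldr (\<otimes>) (xs @ ys) \<one> = foldr (\<otimes>) xs \<one> \<otimes> foldr (\<otimes>) ys \<one>"
  using assms by (induction xs) (auto simp: m_assoc)

lemma (in group) one_in_products_add: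
  assumes S: "set_mset S \<subseteq> carrier G" "\<one> \<in> products G S"
    and T: "set_mset T \<subseteq> carrier G" "\<one> \<in> products G T"
  shows "\<one> \<in> products G (S + T)"
proof -
  obtain xs ys where xs: "mset xs = S" "foldr (\<otimes>) xs \<one> = \<one>"
    and ys: "mset ys = T" "foldr (\<otimes>) ys \<one> = \<one>"
    using S(2) T(2) unfolding products_def permutations_of_multiset_def by force
  have "set xs \<subseteq> carrier G" "set ys \<subseteq> carrier G"
    using xs ys S T by auto
  then have "foldr (\<otimes>) (xs @ ys) \<one> = \<one>"
    using xs(2) ys(2) foldr_mult_append by (metis l_one one_closed)
  moreover have "xs @ ys \<in> permutations_of_multiset (S + T)"
    using xs ys by (simp add: permutations_of_multiset_def)
  ultimately show ?thesis
    unfolding products_def by (metis imageI)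
qed

lemma product_one_monoid_comm_monoid_cancel:
  assumes "group G"
  shows "comm_monoid_cancel (product_one_monoid G)"
proof -
  interpret group G by fact
  show ?thesis
    by (intro comm_monoid_cancelI comm_monoidI) (auto simp: ac_simps one_in_products_add)
qed

lemma Units_product_one_monoid: "Units (product_one_monoid G) = {{#}}"
  by (auto simp: Units_def)

lemma irreducible_product_one_monoid_iff:
  shows "irreducible (product_one_monoid G) A \<longleftrightarrow>
    A \<noteq> {#} \<and> (\<forall>B\<in>carrier (product_one_monoid G). \<forall>C\<in>carrier (product_one_monoid G).
      A = B + C \<longrightarrow> B = {#} \<or> C = {#})"
  (is "?L \<longleftrightarrow> ?R")
proof
  assume L: ?L
  show ?R
  proof (intro conjI ballI impI)
    show "A \<noteq> {#}"
      using L by (auto simp: Divisibility.irreducible_def Units_product_one_monoid)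
  next
    fix B C
    assume B: "B \<in> carrier (product_one_monoid G)" and C: "C \<in> carrier (product_one_monoid G)"
      and A: "A = B + C"
    show "B = {#} \<or> C = {#}"
    proof (rule disjCI)
      assume "C \<noteq> {#}"
      with B C A have "properfactor (product_one_monoid G) B A"
        by (auto simp: properfactor_def factor_def)
      with L B show "B = {#}"
        by (auto simp: Divisibility.irreducible_def Units_product_one_monoid)
    qed
  qed
next
  assume R: ?R
  show ?L
    unfolding Divisibility.irreducible_def Units_product_one_monoid
  proof (intro conjI ballI impI)
    show "A \<notin> {{#}}" using R by simp
  next
    fix B
    assume B: "B \<in> carrier (product_one_monoid G)" "properfactor (product_one_monoid G) B A"
    then obtain C where C: "C \<in> carrier (product_one_monoid G)" "A = B + C"
      by (auto simp: properfactor_def factor_def)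
    have "C \<noteq> {#}"
      using B C by (auto simp: properfactor_def factor_def)
    with R B C show "B \<in> {{#}}" by blast
  qed
qed

lemma set_of_lengths_empty:
  "set_of_lengths (product_one_monoid G) {#} = {0}"
proof -
  have "fs = []" if "factors (product_one_monoid G) fs {#}" for fs
    using that by (cases fs)
      (auto simp: factors_def Divisibility.irreducible_def Units_product_one_monoid)
  moreover have "factors (product_one_monoid G) [] {#}"
    by (simp add: factors_def)
  ultimately show ?thesis
    unfolding set_of_lengths_def by force
qed

end

theory Submission
  imports
    Defs
    "HOL-Library.Disjoint_Sets"
    "HOL-Computational_Algebra.Primes"
begin

text \<open>
  For the first part, take two factorizations \<open>U\<close>, \<open>V\<close> of the same sequence with
  \<open>|U| < |V|\<close>. Some atom of \<open>U\<close> has two consecutive terms \<open>g, h\<close> lying in different atoms of \<open>V\<close>,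
  since otherwise every atom of \<open>U\<close> would lie in a single atom of \<open>V\<close>, and \<open>|V| \<le> |U|\<close>. Replacing \<open>g, h\<close>
  by the single term \<open>gh\<close> keeps the number of atoms in \<open>U\<close>, merges two atoms of \<open>V\<close> into one product-one
  sequence, and shortens the sequence; iterating, the length of \<open>V\<close> reaches every value above \<open>|U|\<close>
  before it falls below it. In an infinite group there are arbitrarily long atoms \<open>A\<close>,
  and \<open>A A\<inverse>\<close> is also the product of the pairs \<open>g g\<inverse>\<close>.

  For the second part, adding terms \<open>1\<close> shifts a set of lengths, so let \<open>2 \<in> L\<close>. Attach to the
  points of the grid \<open>\<Prod>\<^sub>l\<^sub>\<in>\<^sub>L {0,\<dots>,l-1}\<close> group elements that are as independent as possible subject
  to every slice \<open>{y. y\<^sub>l = t}\<close> having product one. A subset with product one then has an indicator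
  function that is a sum of functions of one coordinate each, modulo the order of the chosen elements.
  Unless this order is 2, only one coordinate is involved and the minimal subsets are the slices, so
  the factorizations of the whole grid correspond to the coordinates. For order 2 a subset in which
  several coordinates are involved is minimal together with its complement, which only contributes
  the length 2.
\<close>

section \<open>Atoms and lengths\<close>

definition atoms :: "('a, 'b) monoid_scheme \<Rightarrow> 'a multiset set" where
  "atoms G = {A \<in> carrier (product_one_monoid G). Divisibility.irreducible (product_one_monoid G) A}"

abbreviation lengths :: "('a, 'b) monoid_scheme \<Rightarrow> 'a multiset \<Rightarrow> nat set" where
  "lengths G \<equiv> set_of_lengths (product_one_monoid G)"

lemma one_in_products_iff:
  "\<one>\<^bsub>G\<^esub> \<in> products G S \<longleftrightarrow> (\<exists>xs. mset xs = S \<and> foldr (\<otimes>\<^bsub>G\<^esub>) xs \<one>\<^bsub>G\<^esub> = \<one>\<^bsub>G\<^esub>)"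
  by (force simp: products_def permutations_of_multiset_def)

lemma atoms_iff:
  "A \<in> atoms G \<longleftrightarrow> A \<in> carrier (product_one_monoid G) \<and> A \<noteq> {#} \<and>
    (\<forall>B\<in>carrier (product_one_monoid G). \<forall>C\<in>carrier (product_one_monoid G).
      A = B + C \<longrightarrow> B = {#} \<or> C = {#})"
  unfolding atoms_def mem_Collect_eq irreducible_product_one_monoid_iff ..

lemma atoms_carrier: "A \<in> atoms G \<Longrightarrow> A \<in> carrier (product_one_monoid G)"
  by (simp add: atoms_def)

lemma atoms_nonempty: "A \<in> atoms G \<Longrightarrow> A \<noteq> {#}"
  by (simp add: atoms_iff)

lemma atoms_plusD:
  "\<lbrakk>B + C \<in> atoms G; B \<in> carrier (product_one_monoid G); C \<in> carrier (product_one_monoid G)\<rbrakk>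
    \<Longrightarrow> B = {#} \<or> C = {#}"
  unfolding atoms_iff by blast

text \<open>The product of sequences is commutative, so a factorization is handled from here on as a
  multiset of atoms instead of a list.\<close>

lemma in_lengths_iff:
  "n \<in> lengths G a \<longleftrightarrow> (\<exists>F. set_mset F \<subseteq> atoms G \<and> \<Sum>\<^sub># F = a \<and> size F = n)"
proof -
  have sum: "foldr (\<otimes>\<^bsub>product_one_monoid G\<^esub>) fs \<one>\<^bsub>product_one_monoid G\<^esub> = \<Sum>\<^sub># (mset fs)"
    for fs :: "'a multiset list"
    by (induction fs) auto
  have "n \<in> lengths G a \<longleftrightarrow>
      (\<exists>fs. set fs \<subseteq> atoms G \<and> \<Sum>\<^sub># (mset fs) = a \<and> length fs = n)"
    unfolding set_of_lengths_def factors_def sum atoms_def by blast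
  also have "\<dots> \<longleftrightarrow> (\<exists>F. set_mset F \<subseteq> atoms G \<and> \<Sum>\<^sub># F = a \<and> size F = n)"
    by (metis ex_mset set_mset_mset size_mset)
  finally show ?thesis .
qed

lemma in_lengthsI:
  "\<lbrakk>set_mset F \<subseteq> atoms G; \<Sum>\<^sub># F = a; size F = n\<rbrakk> \<Longrightarrow> n \<in> lengths G a"
  unfolding in_lengths_iff by blast

lemma in_lengthsE:
  assumes "n \<in> lengths G a"
  obtains F where "set_mset F \<subseteq> atoms G" "\<Sum>\<^sub># F = a" "size F = n"
  using assms unfolding in_lengths_iff by blast

lemma lengths_add:
  assumes "m \<in> lengths G a" "n \<in> lengths G b"
  shows "m + n \<in> lengths G (a + b)"
proof -
  obtain E F where "set_mset E \<subseteq> atoms G" "\<Sum>\<^sub># E = a" "size E = m"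
    "set_mset F \<subseteq> atoms G" "\<Sum>\<^sub># F = b" "size F = n"
    using assms by (metis in_lengthsE)
  then show ?thesis
    by (intro in_lengthsI[of "E + F"]) auto
qed

lemma size_le_size_sum_mset:
  assumes "{#} \<notin># F"
  shows "size F \<le> size (\<Sum>\<^sub># F)"
  using assms
proof (induction F)
  case (add A F)
  then have "size A \<ge> 1"
    by (auto simp: Suc_le_eq nonempty_has_size)
  with add show ?case by simp
qed simp

lemma lengths_le_size: "n \<in> lengths G a \<Longrightarrow> n \<le> size a"
  by (metis atoms_nonempty in_lengthsE size_le_size_sum_mset subsetD)

lemma finite_lengths: "finite (lengths G a)"
  by (rule finite_subset[of _ "{..size a}"]) (auto dest: lengths_le_size)

lemma zero_in_lengths_iff: "0 \<in> lengths G a \<longleftrightarrow> a = {#}"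
  by (auto simp: in_lengths_iff)

lemma one_in_lengths_iff: "1 \<in> lengths G a \<longleftrightarrow> a \<in> atoms G"
proof
  assume "1 \<in> lengths G a"
  then obtain F where F: "set_mset F \<subseteq> atoms G" "\<Sum>\<^sub># F = a" "size F = 1"
    by (elim in_lengthsE)
  then obtain A where "F = {#A#}"
    using size_1_singleton_mset by blast
  with F show "a \<in> atoms G"
    by simp
qed (auto intro: in_lengthsI[of "{#a#}"])

context group
begin

lemma foldr_mult_closed [simp]: "set xs \<subseteq> carrier G \<Longrightarrow> foldr (\<otimes>) xs \<one> \<in> carrier G"
  by (induction xs) auto

text \<open>In a group \<open>x \<otimes> y = \<one>\<close> forces
  \<open>y \<otimes> x = \<one>\<close>. Product one is thus invariant under cyclic shifts, and any
  chosen term can be moved to either end.\<close>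

lemma foldr_mult_rotate:
  assumes "set (xs @ ys) \<subseteq> carrier G" "foldr (\<otimes>) (xs @ ys) \<one> = \<one>"
  shows "foldr (\<otimes>) (ys @ xs) \<one> = \<one>"
proof -
  have "set xs \<subseteq> carrier G" "set ys \<subseteq> carrier G"
    using assms by auto
  then show ?thesis
    using assms(2) by (simp only: foldr_mult_append) (metis foldr_mult_closed inv_comm)
qed

lemma sum_mset_in_carrier:
  "set_mset F \<subseteq> carrier (product_one_monoid G) \<Longrightarrow> \<Sum>\<^sub># F \<in> carrier (product_one_monoid G)"
  by (induction F) (auto simp: one_in_products_add)

lemma sum_atoms_in_carrier:
  "set_mset F \<subseteq> atoms G \<Longrightarrow> \<Sum>\<^sub># F \<in> carrier (product_one_monoid G)"
  using atoms_carrier by (intro sum_mset_in_carrier) blast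

lemma lengths_atom:
  assumes "a \<in> atoms G"
  shows "lengths G a = {1}"
proof -
  have "n = 1" if "n \<in> lengths G a" for n
  proof -
    obtain F where F: "set_mset F \<subseteq> atoms G" "\<Sum>\<^sub># F = a" "size F = n"
      using \<open>n \<in> lengths G a\<close> by (elim in_lengthsE)
    with assms have "F \<noteq> {#}"
      by (auto dest: atoms_nonempty)
    then obtain A E where E: "F = add_mset A E"
      by (metis multiset_cases)
    have "A \<in> carrier (product_one_monoid G)" "\<Sum>\<^sub># E \<in> carrier (product_one_monoid G)"
      using F E by (auto simp del: product_one_monoid_simps
          intro: atoms_carrier sum_atoms_in_carrier)
    moreover have "A + \<Sum>\<^sub># E \<in> atoms G" "A \<noteq> {#}"
      using F E assms by (auto dest: atoms_nonempty)
    ultimately have "\<Sum>\<^sub># E = {#}"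
      by (metis atoms_plusD)
    then have "E = {#}"
      using F E size_le_size_sum_mset[of E] by (auto dest: atoms_nonempty)
    with F E show "n = 1" by simp
  qed
  moreover have "1 \<in> lengths G a"
    unfolding one_in_lengths_iff by (fact assms)
  ultimately show ?thesis by blast
qed

lemma lengths_nonempty:
  assumes "a \<in> carrier (product_one_monoid G)"
  shows "lengths G a \<noteq> {}"
  using assms
proof (induction "size a" arbitrary: a rule: less_induct)
  case less
  show ?case
  proof (cases "a = {#} \<or> a \<in> atoms G")
    case True
    then show ?thesis
      by (auto simp: set_of_lengths_empty lengths_atom)
  next
    case False
    with less.prems obtain B C where BC: "B \<in> carrier (product_one_monoid G)"
      "C \<in> carrier (product_one_monoid G)" "a = B + C" "B \<noteq> {#}" "C \<noteq> {#}"
      unfolding atoms_iff by blast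
    then have "lengths G B \<noteq> {}" "lengths G C \<noteq> {}"
      using less.hyps by (auto simp del: product_one_monoid_simps simp: nonempty_has_size)
    with BC show ?thesis
      by (metis equals0I ex_in_conv lengths_add)
  qed
qed

lemma singleton_one_atom: "{#\<one>#} \<in> atoms G"
proof -
  have "\<one> \<in> products G {#\<one>#}"
    unfolding one_in_products_iff by (rule exI[of _ "[\<one>]"]) simp
  then show ?thesis
    by (auto simp: atoms_iff add_eq_conv_ex single_is_union)
qed

text \<open>Deleting the identity keeps the product, so \<open>{#\<one>#}\<close> splits off the
  atom.\<close>

lemma atom_containing_one:
  assumes "A \<in> atoms G" "\<one> \<in># A"
  shows "A = {#\<one>#}"
proof -
  from assms(2) obtain B where B: "A = add_mset \<one> B"
    by (metis mset_add)
  have A: "set_mset A \<subseteq> carrier G" "\<one> \<in> products G A"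
    using atoms_carrier[OF assms(1)] by auto
  from A(2) obtain xs where xs: "mset xs = A" "foldr (\<otimes>) xs \<one> = \<one>"
    unfolding one_in_products_iff by blast
  then obtain ys zs where yz: "xs = ys @ \<one> # zs"
    using assms(2) by (metis set_mset_mset split_list)
  have car: "set ys \<subseteq> carrier G" "set zs \<subseteq> carrier G"
    using xs yz A by auto
  have "foldr (\<otimes>) (ys @ \<one> # zs) \<one> = foldr (\<otimes>) (ys @ zs) \<one>"
    using car by (subst (1 2) foldr_mult_append) auto
  then have "\<one> \<in> products G B"
    unfolding one_in_products_iff using xs yz B by (intro exI[of _ "ys @ zs"]) auto
  then have "B \<in> carrier (product_one_monoid G)"
    using A B by auto
  then show ?thesis
    using atoms_plusD[of "{#\<one>#}" B] assms(1) B atoms_carrier[OF singleton_one_atom] by auto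
qed

text \<open>Every factorization of the longer sequence contains \<open>{#\<one>#}\<close>, the only
  atom in which \<open>\<one>\<close> occurs, and removing it undoes the addition of this
  atom.\<close>

lemma lengths_add_one: "lengths G (add_mset \<one> a) = Suc ` lengths G a"
proof -
  have "n \<in> Suc ` lengths G a" if "n \<in> lengths G (add_mset \<one> a)" for n
  proof -
    obtain F where F: "set_mset F \<subseteq> atoms G" "\<Sum>\<^sub># F = add_mset \<one> a" "size F = n"
      using \<open>n \<in> lengths G (add_mset \<one> a)\<close> by (elim in_lengthsE)
    then have "\<one> \<in># \<Sum>\<^sub># F" by simp
    then obtain A where "A \<in># F" "\<one> \<in># A"
      by auto
    with F(1) atom_containing_one have "{#\<one>#} \<in># F"
      by blast
    then obtain E where "F = add_mset {#\<one>#} E"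
      by (metis mset_add)
    with F show ?thesis
      by (auto intro!: in_lengthsI[of E])
  qed
  moreover have "Suc n \<in> lengths G (add_mset \<one> a)" if "n \<in> lengths G a" for n
    using lengths_add[of 1 G "{#\<one>#}" n a] that lengths_atom[OF singleton_one_atom] by simp
  ultimately show ?thesis by blast
qed

lemma lengths_add_ones: "lengths G (replicate_mset d \<one> + a) = (+) d ` lengths G a"
  by (induction d) (simp_all add: lengths_add_one image_image)

lemma replicate_one_in_carrier: "replicate_mset d \<one> \<in> carrier (product_one_monoid G)"
  by (induction d)
    (use one_in_products_add[of "{#\<one>#}"] atoms_carrier[OF singleton_one_atom] in auto)

end

section \<open>Unions of sets of lengths\<close>

context group
begin

section \<open>Fusing two adjacent terms of an atom\<close>

lemma foldr_mult_fuse: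
  assumes "set ys \<subseteq> carrier G" "set zs \<subseteq> carrier G" "g \<in> carrier G" "h \<in> carrier G"
  shows "foldr (\<otimes>) (ys @ (g \<otimes> h) # zs) \<one> = foldr (\<otimes>) (ys @ g # h # zs) \<one>"
  using assms by (simp add: m_assoc)

text \<open>In a splitting of the fused sequence one factor contains \<open>g \<otimes> h\<close>.
  Unfolding that term into \<open>g\<close>, \<open>h\<close> yields a splitting of \<open>u\<close>
  with the same other factor, which is therefore empty.\<close>

lemma fuse_in_atom:
  assumes u: "u \<in> atoms G" "mset (ys @ g # h # zs) = u" "foldr (\<otimes>) (ys @ g # h # zs) \<one> = \<one>"
  shows "mset (ys @ (g \<otimes> h) # zs) \<in> atoms G"
proof -
  let ?u = "mset (ys @ (g \<otimes> h) # zs)"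
  have car: "set ys \<subseteq> carrier G" "set zs \<subseteq> carrier G" "g \<in> carrier G" "h \<in> carrier G"
    using atoms_carrier[OF u(1)] u(2) by auto
  have "foldr (\<otimes>) (ys @ (g \<otimes> h) # zs) \<one> = foldr (\<otimes>) (ys @ g # h # zs) \<one>"
    using car by (intro foldr_mult_fuse)
  then have "\<one> \<in> products G ?u"
    unfolding one_in_products_iff using u(3) by (intro exI[of _ "ys @ (g \<otimes> h) # zs"]) auto
  with car have "?u \<in> carrier (product_one_monoid G)"
    by auto
  moreover have "B = {#} \<or> C = {#}"
    if "?u = B + C" "g \<otimes> h \<in># B" and B: "B \<in> carrier (product_one_monoid G)"
      and C: "C \<in> carrier (product_one_monoid G)" for B C
  proof -
    obtain xs where xs: "mset xs = B" "foldr (\<otimes>) xs \<one> = \<one>"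
      using B by (auto simp: one_in_products_iff)
    then obtain as bs where xs_eq: "xs = as @ (g \<otimes> h) # bs"
      using \<open>g \<otimes> h \<in># B\<close> by (metis set_mset_mset split_list)
    have car': "set as \<subseteq> carrier G" "set bs \<subseteq> carrier G"
      using B xs xs_eq by auto
    let ?B = "mset (as @ g # h # bs)"
    have "foldr (\<otimes>) (as @ (g \<otimes> h) # bs) \<one> = foldr (\<otimes>) (as @ g # h # bs) \<one>"
      using car car' by (intro foldr_mult_fuse)
    then have "\<one> \<in> products G ?B"
      unfolding one_in_products_iff using xs xs_eq by (intro exI[of _ "as @ g # h # bs"]) auto
    then have "?B \<in> carrier (product_one_monoid G)"
      using car car' by auto
    moreover have "u = ?B + C"
      using that(1) xs xs_eq u(2) by auto
    ultimately have "C = {#}"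
      using atoms_plusD[of ?B C] u(1) C by auto
    then show ?thesis ..
  qed
  moreover have "g \<otimes> h \<in># B \<or> g \<otimes> h \<in># C" if "?u = B + C" for B C
    by (metis that in_set_conv_decomp set_mset_mset union_iff)
  ultimately show ?thesis
    unfolding atoms_iff by (metis add.commute empty_not_add_mset mset.simps(2) mset_append union_mset_add_mset_right)
qed

text \<open>Cyclic shifts put \<open>g\<close> at the end of one product and \<open>h\<close> at the
  start of the other, so concatenation makes them adjacent.\<close>

lemma fuse_across:
  assumes v: "add_mset g v \<in> carrier (product_one_monoid G)"
    and w: "add_mset h w \<in> carrier (product_one_monoid G)"
  shows "add_mset (g \<otimes> h) (v + w) \<in> carrier (product_one_monoid G)"
proof -
  obtain xs where xs: "mset xs = add_mset g v" "foldr (\<otimes>) xs \<one> = \<one>"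
    using v by (auto simp: one_in_products_iff)
  then obtain as bs where xs_eq: "xs = as @ g # bs"
    by (metis set_mset_mset split_list union_single_eq_member)
  obtain ys where ys: "mset ys = add_mset h w" "foldr (\<otimes>) ys \<one> = \<one>"
    using w by (auto simp: one_in_products_iff)
  then obtain cs ds where ys_eq: "ys = cs @ h # ds"
    by (metis set_mset_mset split_list union_single_eq_member)
  have "set xs = set_mset (add_mset g v)" "set ys = set_mset (add_mset h w)"
    by (simp_all flip: xs(1) ys(1))
  then have "set xs \<subseteq> carrier G" "set ys \<subseteq> carrier G"
    using v w by auto
  then have car: "set as \<subseteq> carrier G" "set bs \<subseteq> carrier G" "g \<in> carrier G"
    "set cs \<subseteq> carrier G" "set ds \<subseteq> carrier G" "h \<in> carrier G"
    using xs_eq ys_eq by auto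
  have 1: "foldr (\<otimes>) ((bs @ as) @ [g]) \<one> = \<one>"
    using foldr_mult_rotate[of "as @ [g]" bs] xs(2) xs_eq car by simp
  have 2: "foldr (\<otimes>) ([h] @ (ds @ cs)) \<one> = \<one>"
    using foldr_mult_rotate[of cs "h # ds"] ys(2) ys_eq car by simp
  have "foldr (\<otimes>) ((bs @ as) @ [g \<otimes> h] @ (ds @ cs)) \<one>
      = foldr (\<otimes>) (((bs @ as) @ [g]) @ ([h] @ (ds @ cs))) \<one>"
    using car foldr_mult_fuse[of "bs @ as" "ds @ cs"] by simp
  also have "\<dots> = \<one>"
    using car by (subst foldr_mult_append) (use 1 2 in auto)
  finally have "\<one> \<in> products G (add_mset (g \<otimes> h) (v + w))"
    unfolding one_in_products_iff using xs xs_eq ys ys_eq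
    by (intro exI[of _ "(bs @ as) @ [g \<otimes> h] @ (ds @ cs)"]) auto
  with v w show ?thesis by auto
qed

text \<open>The two atoms are distinct members of the multiset \<open>V\<close> but may be equal as
  sequences, hence the form \<open>{#v, w#} \<subseteq># V\<close>. Without such a pair all terms of
  an atom of \<open>U\<close> would lie in one and the same member of \<open>V\<close>. Excluding
  \<open>\<one>\<close> gives each atom of \<open>U\<close> at least two terms, hence each term a
  neighbour.\<close>

lemma exists_fusable_pair:
  assumes U: "set_mset U \<subseteq> atoms G" and V: "set_mset V \<subseteq> atoms G"
    and sum: "\<Sum>\<^sub># U = \<Sum>\<^sub># V" and size: "size U < size V" and one: "\<one> \<notin># \<Sum>\<^sub># U"
  shows "\<exists>u ys g h zs v w. u \<in># U \<and> mset (ys @ g # h # zs) = u \<and>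
    foldr (\<otimes>) (ys @ g # h # zs) \<one> = \<one> \<and> {#v, w#} \<subseteq># V \<and> g \<in># v \<and> h \<in># w"
proof (rule ccontr)
  assume contra: "\<not> ?thesis"
  have no_pair: "\<not> {#v, w#} \<subseteq># V" if "u \<in># U" "mset (ys @ g # h # zs) = u"
      "foldr (\<otimes>) (ys @ g # h # zs) \<one> = \<one>" "g \<in># v" "h \<in># w" for u ys g h zs v w
    using contra that by blast
  define I where "I g = filter_mset (\<lambda>v. g \<in># v) V" for g
  have I_nonempty: "I g \<noteq> {#}" if "u \<in># U" "g \<in># u" for u g
  proof -
    have "g \<in># \<Sum>\<^sub># V"
      using that sum by (metis in_Union_mset_iff)
    then obtain v where "v \<in># V" "g \<in># v"
      by auto
    then have "v \<in># I g"
      by (simp add: I_def)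
    then show ?thesis by auto
  qed
  have I_adj: "\<exists>v. I g = {#v#} \<and> I h = {#v#}"
    if "u \<in># U" "mset (ys @ g # h # zs) = u" "foldr (\<otimes>) (ys @ g # h # zs) \<one> = \<one>"
    for u ys g h zs
  proof -
    have "I g \<noteq> {#}" "I h \<noteq> {#}"
      using that I_nonempty by auto
    then obtain v J w K where J: "I g = add_mset v J" and K: "I h = add_mset w K"
      by (metis multiset_cases)
    \<comment> \<open>Both atoms occur in \<open>V\<close> but not as two separate members, so they
      coincide and occur only once.\<close>
    have eq: "v' = w' \<and> count V v' = 1" if "v' \<in># I g" "w' \<in># I h" for v' w'
    proof -
      have "v' \<in># V" "g \<in># v'" "w' \<in># V" "h \<in># w'"
        using that by (auto simp: I_def)
      then have "\<not> {#v', w'#} \<subseteq># V"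
        using no_pair[OF \<open>u \<in># U\<close> \<open>mset (ys @ g # h # zs) = u\<close>
          \<open>foldr (\<otimes>) (ys @ g # h # zs) \<one> = \<one>\<close>] by blast
      then have "\<not> (if v' = w' then 1 else 0) < count V w'"
        using \<open>v' \<in># V\<close> by (simp add: insert_subset_eq_iff in_diff_count split: if_splits)
      moreover have "count V w' > 0"
        using \<open>w' \<in># V\<close> by simp
      ultimately show ?thesis
        by (cases "v' = w'") (simp_all del: count_greater_zero_iff)
    qed
    have single: "M = {#v#}" if "M \<in> {I g, I h}" for M
    proof (rule multiset_eqI)
      fix x
      have *: "y = v \<and> count V v = 1" if "y \<in># I g \<or> y \<in># I h" for y
        using eq[of y w] eq[of v y] eq[of v w] J K that by auto
      have "w = v" "count V v = 1"
        using *[of w] K by auto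
      have "count M v \<le> count V v"
        using that by (auto simp: I_def)
      moreover have "v \<in># M"
        using that J K \<open>w = v\<close> by auto
      ultimately have "count M v = 1"
        using \<open>count V v = 1\<close> by (metis count_greater_eq_one_iff le_antisym)
      moreover have "count M x = 0" if "x \<noteq> v"
        using * that \<open>M \<in> {I g, I h}\<close> by (auto simp: count_eq_zero_iff)
      ultimately show "count M x = count {#v#} x"
        by (cases "x = v") auto
    qed
    have "I g = {#v#}" "I h = {#v#}"
      by (rule single, simp)+
    then show ?thesis by blast
  qed
  have I_single: "\<exists>v. \<forall>g\<in>#u. I g = {#v#}" if "u \<in># U" for u
  proof -
    have u: "u \<in> atoms G"
      using U that by blast
    then obtain xs where xs: "mset xs = u" "foldr (\<otimes>) xs \<one> = \<one>"
      using atoms_carrier[OF u] by (auto simp: one_in_products_iff)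
    have "set xs \<subseteq> carrier G"
      using atoms_carrier[OF u] xs(1) by auto
    have "\<one> \<notin> set xs"
      using one xs(1) that by auto
    \<comment> \<open>A one-term sequence with product one would be \<open>{#\<one>#}\<close>, so
      \<open>xs\<close> has at least two terms.\<close>
    with xs atoms_nonempty[OF u] \<open>set xs \<subseteq> carrier G\<close> obtain a b zs where xs_eq: "xs = a # b # zs"
      by (cases xs rule: remdups_adj.cases) auto
    \<comment> \<open>Consecutive pairs overlap, so the common atom propagates along
      \<open>xs\<close>.\<close>
    have "\<exists>v. \<forall>g\<in>set (a # b # zs). I g = {#v#}" if "xs = ys @ a # b # zs" for ys a b zs
      using that
    proof (induction zs arbitrary: ys a b)
      case Nil
      then show ?case
        using I_adj[OF \<open>u \<in># U\<close>, of ys a b "[]"] xs by auto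
    next
      case (Cons c zs)
      then obtain v where "\<forall>g\<in>set (b # c # zs). I g = {#v#}"
        using Cons.IH[of "ys @ [a]" b c] by auto
      moreover obtain w where "I a = {#w#}" "I b = {#w#}"
        using I_adj[OF \<open>u \<in># U\<close>, of ys a b "c # zs"] xs Cons.prems by auto
      ultimately show ?case
        by (intro exI[of _ w]) auto
    qed
    from this[of "[]" a b zs] show ?thesis
      using xs xs_eq by auto
  qed
  then obtain f where f: "\<And>u g. \<lbrakk>u \<in># U; g \<in># u\<rbrakk> \<Longrightarrow> I g = {#f u#}"
    by metis
  \<comment> \<open>The map \<open>f\<close> reaches all atoms of \<open>V\<close>, and none is
    repeated, so \<open>V\<close> has no more members than \<open>U\<close> has distinct
    atoms.\<close>
  have V1: "v \<in> f ` set_mset U \<and> count V v = 1" if "v \<in># V" for v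
  proof -
    have "v \<in> atoms G"
      using V that by blast
    then obtain g where "g \<in># v"
      using atoms_nonempty by blast
    then have "g \<in># \<Sum>\<^sub># U"
      using that unfolding sum by auto
    then obtain u where u: "u \<in># U" "g \<in># u"
      by auto
    have "v \<in># I g"
      using \<open>g \<in># v\<close> that by (simp add: I_def)
    with f[OF u] have "v = f u" by simp
    moreover have "count (I g) v = count V v"
      using \<open>g \<in># v\<close> by (simp add: I_def)
    ultimately show ?thesis
      using f[OF u] u by simp
  qed
  have "size V = card (set_mset V)"
    unfolding size_multiset_overloaded_eq using V1 by simp
  also have "\<dots> \<le> card (f ` set_mset U)"
    using V1 by (intro card_mono) auto
  also have "\<dots> \<le> card (set_mset U)"
    by (rule card_image_le) simp
  also have "\<dots> \<le> size U"
    unfolding size_multiset_overloaded_eq card_eq_sum by (rule sum_mono) simp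
  finally show False
    using size by simp
qed


text \<open>Induction on the length of the common product. After a fusion the merged sequence may
  factor into many atoms, so the size of \<open>V\<close> can grow, but a fusion lowers it by at
  most one; hence its first value below \<open>m\<close> is exactly \<open>m - 1\<close>.\<close>

lemma shorten_longer_factorization:
  assumes "set_mset U \<subseteq> atoms G" "set_mset V \<subseteq> atoms G" "\<Sum>\<^sub># U = \<Sum>\<^sub># V"
    and "size U < m" "m \<le> size V"
  shows "\<exists>U' V'. set_mset U' \<subseteq> atoms G \<and> set_mset V' \<subseteq> atoms G \<and> \<Sum>\<^sub># U' = \<Sum>\<^sub># V' \<and>
    size U' = size U \<and> size V' = m - 1"
  using assms
proof (induction "size (\<Sum>\<^sub># U)" arbitrary: U V m rule: less_induct)
  case less
  show ?case
  proof (cases "\<one> \<in># \<Sum>\<^sub># U")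
    case True
    \<comment> \<open>A term \<open>\<one>\<close> forces the atom \<open>{#\<one>#}\<close> in both
      factorizations. It is cancelled, and put back after applying the induction hypothesis to
      \<open>m - 1\<close>.\<close>
    have *: "\<exists>W'. W = add_mset {#\<one>#} W'"
      if W: "set_mset W \<subseteq> atoms G" "\<one> \<in># \<Sum>\<^sub># W" for W
    proof -
      obtain A where "A \<in># W" "\<one> \<in># A"
        using W(2) by auto
      with W(1) have "{#\<one>#} \<in># W"
        using atom_containing_one by blast
      then show ?thesis
        by (metis mset_add)
    qed
    obtain U0 where U0: "U = add_mset {#\<one>#} U0"
      using *[of U] less.prems(1) True by blast
    obtain V0 where V0: "V = add_mset {#\<one>#} V0"
      using *[of V] less.prems(2,3) True by metis
    have "\<exists>U' V'. set_mset U' \<subseteq> atoms G \<and> set_mset V' \<subseteq> atoms G \<and> \<Sum>\<^sub># U' = \<Sum>\<^sub># V' \<and>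
      size U' = size U0 \<and> size V' = (m - 1) - 1"
      by (rule less.hyps) (use less.prems U0 V0 in auto)
    then obtain U' V' where "set_mset U' \<subseteq> atoms G" "set_mset V' \<subseteq> atoms G"
      "\<Sum>\<^sub># U' = \<Sum>\<^sub># V'" "size U' = size U0" "size V' = (m - 1) - 1"
      by blast
    then show ?thesis
      using U0 less.prems singleton_one_atom
      by (intro exI[of _ "add_mset {#\<one>#} U'"] exI[of _ "add_mset {#\<one>#} V'"]) auto
  next
    case False
    obtain u ys g h zs v w where uvw: "u \<in># U" "mset (ys @ g # h # zs) = u"
      "foldr (\<otimes>) (ys @ g # h # zs) \<one> = \<one>" "{#v, w#} \<subseteq># V" "g \<in># v" "h \<in># w"
      using exists_fusable_pair[of U V] less.prems False by auto
    define u' where "u' = mset (ys @ (g \<otimes> h) # zs)"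
    have "u' \<in> atoms G"
      using fuse_in_atom[of u ys g h zs] uvw less.prems(1) by (auto simp: u'_def)
    obtain U0 where U0: "U = add_mset u U0"
      using uvw(1) by (metis mset_add)
    obtain V0 where V0: "V = {#v, w#} + V0"
      using uvw(4) by (metis subset_mset.le_iff_add)
    obtain v0 w0 where v0: "v = add_mset g v0" and w0: "w = add_mset h w0"
      using uvw(5,6) by (metis mset_add)
    define x where "x = add_mset (g \<otimes> h) (v0 + w0)"
    have "x \<in> carrier (product_one_monoid G)"
      unfolding x_def using V0 v0 w0 less.prems(2)
      by (intro fuse_across) (simp_all del: product_one_monoid_simps add: atoms_carrier)
    then obtain t where "t \<in> lengths G x"
      using lengths_nonempty by blast
    then obtain X where X: "set_mset X \<subseteq> atoms G" "\<Sum>\<^sub># X = x" "size X = t"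
      by (elim in_lengthsE)
    have "t \<noteq> 0"
      using \<open>t \<in> lengths G x\<close> zero_in_lengths_iff[of G x] by (cases "t = 0") (auto simp: x_def)
    define U' where "U' = add_mset u' U0"
    define V' where "V' = X + V0"
    have UV': "set_mset U' \<subseteq> atoms G" "set_mset V' \<subseteq> atoms G" "size U' = size U"
      "size V' = size V - 2 + t"
      using less.prems(1,2) U0 V0 X \<open>u' \<in> atoms G\<close> by (auto simp: U'_def V'_def)
    \<comment> \<open>The exchange of terms is recorded additively, which avoids multiset
      subtraction; cancelling \<open>{#g, h#}\<close> later yields the equality of the new
      products.\<close>
    have u_u': "u + {#g \<otimes> h#} = u' + {#g, h#}"
      using uvw(2) by (auto simp: u'_def)
    have x_vw: "v + w + {#g \<otimes> h#} = x + {#g, h#}"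
      by (simp add: x_def v0 w0)
    have "\<Sum>\<^sub># U' + {#g, h#} = \<Sum>\<^sub># U + {#g \<otimes> h#}"
      using u_u' by (simp add: U'_def U0 ac_simps)
    moreover have "\<Sum>\<^sub># V' + {#g, h#} = \<Sum>\<^sub># V + {#g \<otimes> h#}"
      using x_vw by (simp add: V'_def V0 X(2) ac_simps)
    ultimately have sum: "\<Sum>\<^sub># U' = \<Sum>\<^sub># V'"
      using less.prems(3) by (metis add_right_cancel)
    have size: "size (\<Sum>\<^sub># U') < size (\<Sum>\<^sub># U)"
      using arg_cong[OF \<open>\<Sum>\<^sub># U' + {#g, h#} = \<Sum>\<^sub># U + {#g \<otimes> h#}\<close>, of size] by simp
    show ?thesis
    proof (cases "m \<le> size V'")
      case True
      then show ?thesis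
        using less.hyps[OF size UV'(1,2) sum, of m] UV'(3) less.prems(4) by auto
    next
      case False
      then have "size V' = m - 1"
        using UV'(4) less.prems(5) \<open>t \<noteq> 0\<close> V0 by simp
      then show ?thesis
        using UV' sum by blast
    qed
  qed
qed

section \<open>Unions of sets of lengths as intervals\<close>

lemma in_union_of_lengths_iff:
  "n \<in> union_of_lengths G k \<longleftrightarrow> (\<exists>a\<in>carrier (product_one_monoid G). k \<in> lengths G a \<and> n \<in> lengths G a)"
  by (auto simp: union_of_lengths_def system_of_lengths_def simp del: product_one_monoid_simps)

lemma in_union_of_lengths_atoms_iff:
  "n \<in> union_of_lengths G k \<longleftrightarrow> (\<exists>U V. set_mset U \<subseteq> atoms G \<and> set_mset V \<subseteq> atoms G \<and>
    \<Sum>\<^sub># U = \<Sum>\<^sub># V \<and> size U = k \<and> size V = n)"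
proof
  assume "n \<in> union_of_lengths G k"
  then obtain a where "k \<in> lengths G a" "n \<in> lengths G a"
    unfolding in_union_of_lengths_iff by blast
  then show "\<exists>U V. set_mset U \<subseteq> atoms G \<and> set_mset V \<subseteq> atoms G \<and>
      \<Sum>\<^sub># U = \<Sum>\<^sub># V \<and> size U = k \<and> size V = n"
    by (metis in_lengthsE)
next
  assume "\<exists>U V. set_mset U \<subseteq> atoms G \<and> set_mset V \<subseteq> atoms G \<and>
      \<Sum>\<^sub># U = \<Sum>\<^sub># V \<and> size U = k \<and> size V = n"
  then obtain U V where "set_mset U \<subseteq> atoms G" "set_mset V \<subseteq> atoms G"
    "\<Sum>\<^sub># U = \<Sum>\<^sub># V" "size U = k" "size V = n"
    by blast
  then show "n \<in> union_of_lengths G k"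
    unfolding in_union_of_lengths_iff
    by (intro bexI[of _ "\<Sum>\<^sub># U"] conjI) (auto intro: in_lengthsI sum_atoms_in_carrier simp del: product_one_monoid_simps)
qed

lemma union_of_lengths_commute: "n \<in> union_of_lengths G k \<longleftrightarrow> k \<in> union_of_lengths G n"
  unfolding in_union_of_lengths_iff by blast

lemma union_of_lengths_self: "k \<in> union_of_lengths G k"
proof -
  have "k \<in> lengths G (replicate_mset k \<one>)"
    using lengths_add_ones[of k "{#}"] by (simp add: set_of_lengths_empty)
  then show ?thesis
    unfolding in_union_of_lengths_iff using replicate_one_in_carrier by blast
qed

lemma union_of_lengths_shift:
  assumes "n \<in> union_of_lengths G k"
  shows "d + n \<in> union_of_lengths G (d + k)"
proof -
  obtain a where a: "a \<in> carrier (product_one_monoid G)" "k \<in> lengths G a" "n \<in> lengths G a"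
    using assms unfolding in_union_of_lengths_iff by blast
  have "replicate_mset d \<one> + a \<in> carrier (product_one_monoid G)"
    using replicate_one_in_carrier[of d] a(1) one_in_products_add by auto
  then show ?thesis
    unfolding in_union_of_lengths_iff using a lengths_add_ones[of d a] by blast
qed

text \<open>The factorization of size \<open>n\<close> is shortened one atom at a time, while the
  other one keeps size \<open>k\<close>.\<close>

lemma union_of_lengths_upward:
  assumes "n \<in> union_of_lengths G k" "k \<le> m" "m \<le> n"
  shows "m \<in> union_of_lengths G k"
  using assms(3)
proof (induction m rule: inc_induct)
  case (step j)
  then obtain U V where "set_mset U \<subseteq> atoms G" "set_mset V \<subseteq> atoms G"
    "\<Sum>\<^sub># U = \<Sum>\<^sub># V" "size U = k" "size V = Suc j"
    unfolding in_union_of_lengths_atoms_iff by blast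
  then have "\<exists>U' V'. set_mset U' \<subseteq> atoms G \<and> set_mset V' \<subseteq> atoms G \<and> \<Sum>\<^sub># U' = \<Sum>\<^sub># V' \<and>
      size U' = k \<and> size V' = Suc j - 1"
    using shorten_longer_factorization[of U V "Suc j"] assms(2) step.hyps by auto
  then show ?case
    unfolding in_union_of_lengths_atoms_iff by auto
qed (fact assms(1))

text \<open>Adding \<open>m - n\<close> terms \<open>\<one>\<close> turns the relation between
  \<open>n\<close> and \<open>k\<close> into one between \<open>m\<close> and
  \<open>m - n + k\<close>. As \<open>k\<close> lies between these two, the upward case relates
  \<open>m\<close> to \<open>k\<close>, and symmetry finishes.\<close>

lemma union_of_lengths_downward:
  assumes "n \<in> union_of_lengths G k" "n \<le> m" "m \<le> k"
  shows "m \<in> union_of_lengths G k"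
proof -
  have "(m - n) + k \<in> union_of_lengths G ((m - n) + n)"
    using assms(1) union_of_lengths_commute union_of_lengths_shift by blast
  then have "k \<in> union_of_lengths G m"
    using union_of_lengths_upward[of "(m - n) + k" m k] assms by simp
  then show ?thesis
    using union_of_lengths_commute by blast
qed

lemma union_of_lengths_convex:
  assumes "l \<in> union_of_lengths G k" "n \<in> union_of_lengths G k" "l \<le> m" "m \<le> n"
  shows "m \<in> union_of_lengths G k"
proof (cases "k \<le> m")
  case True
  then show ?thesis
    using union_of_lengths_upward assms(2,4) by blast
next
  case False
  then show ?thesis
    using union_of_lengths_downward[OF assms(1,3)] by simp
qed

lemma union_of_lengths_interval:
  "union_of_lengths G k = {n. lower_elasticity G k \<le> n \<and> enat n \<le> upper_elasticity G k}"
    (is "?U = ?I")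
proof
  show "?U \<subseteq> ?I"
    unfolding lower_elasticity_def upper_elasticity_def by (auto intro: cInf_lower SUP_upper)
next
  show "?I \<subseteq> ?U"
  proof safe
    fix m
    assume m: "lower_elasticity G k \<le> m" "enat m \<le> upper_elasticity G k"
    have "lower_elasticity G k \<in> ?U"
      unfolding lower_elasticity_def using union_of_lengths_self by (intro Inf_nat_def1) blast
    \<comment> \<open>This treats finite and infinite suprema alike: otherwise \<open>m - 1\<close>
      bounds the union, where \<open>m > 0\<close> makes it a genuine predecessor.\<close>
    moreover have "\<exists>n\<in>?U. m \<le> n"
    proof (rule ccontr)
      assume "\<not> ?thesis"
      then have *: "n < m" if "n \<in> ?U" for n
        using that by (meson not_le)
      then have "m > 0"
        using union_of_lengths_self[of k] by fastforce
      have "upper_elasticity G k \<le> enat (m - 1)"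
        unfolding upper_elasticity_def using * by (intro SUP_least) fastforce
      with m(2) \<open>m > 0\<close> show False
        by (metis diff_less enat_ord_simps(1) leD less_numeral_extra(1) order_trans)
    qed
    ultimately show "m \<in> ?U"
      using m(1) union_of_lengths_convex by blast
  qed
qed

section \<open>Long atoms in an infinite group\<close>

text \<open>A product-one sequence using the new \<open>g\<close> rotates to
  \<open>g \<otimes> x = \<one>\<close>, where \<open>x\<close> is the product of an ordering of a
  subsequence of \<open>xs\<close>. Only finitely many such \<open>x\<close> exist, so an infinite
  group has a \<open>g\<close> avoiding all \<open>inv x\<close>.\<close>

lemma product_one_free_extend:
  assumes inf: "infinite (carrier G)" and xs: "set xs \<subseteq> carrier G"
    and free: "\<And>T. \<lbrakk>T \<subseteq># mset xs; T \<noteq> {#}\<rbrakk> \<Longrightarrow> \<one> \<notin> products G T"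
  obtains g where "g \<in> carrier G" "\<And>T. \<lbrakk>T \<subseteq># mset (g # xs); T \<noteq> {#}\<rbrakk> \<Longrightarrow> \<one> \<notin> products G T"
proof -
  let ?Y = "{ys. mset ys \<subseteq># mset xs}"
  have "finite ?Y"
    by (rule finite_subset[OF _ finite_lists_length_le[of "set xs" "length xs"]])
      (auto dest: mset_subset_eqD size_mset_mono simp flip: set_mset_mset size_mset simp del: set_mset_mset)
  then obtain g where g: "g \<in> carrier G" "g \<notin> (\<lambda>ys. inv (foldr (\<otimes>) ys \<one>)) ` ?Y"
    using inf by (metis finite_imageI finite_subset subsetI)
  have "\<one> \<notin> products G T" if T: "T \<subseteq># mset (g # xs)" "T \<noteq> {#}" for T
  proof (cases "T \<subseteq># mset xs")
    case True
    then show ?thesis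
      using free T(2) by blast
  next
    case False
    then obtain S where S: "T = add_mset g S" "S \<subseteq># mset xs"
      using T(1) by (metis insert_subset_eq_iff mset.simps(2) add_mset_remove_trivial diff_single_trivial
          mset_add subset_eq_diff_conv union_single_eq_diff add_mset_add_single)
    show ?thesis
    proof
      assume "\<one> \<in> products G T"
      then obtain zs where zs: "mset zs = T" "foldr (\<otimes>) zs \<one> = \<one>"
        unfolding one_in_products_iff by blast
      then obtain as bs where zs_eq: "zs = as @ g # bs"
        using S(1) by (metis set_mset_mset split_list union_single_eq_member)
      then have ba: "mset (bs @ as) = S"
        using zs(1) S(1) by auto
      then have "set (bs @ as) \<subseteq> carrier G"
        using S(2) xs by (metis mset_subset_eqD set_mset_mset subset_iff)
      then have "g \<otimes> foldr (\<otimes>) (bs @ as) \<one> = \<one>"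
        using foldr_mult_rotate[of as "g # bs"] zs zs_eq g(1) by simp
      then have "g = inv (foldr (\<otimes>) (bs @ as) \<one>)"
        using g(1) \<open>set (bs @ as) \<subseteq> carrier G\<close> by (metis foldr_mult_closed inv_equality)
      then show False
        using g(2) ba S(2) by blast
    qed
  qed
  with g(1) that show thesis by blast
qed

lemma exists_product_one_free:
  assumes "infinite (carrier G)"
  shows "\<exists>xs. length xs = n \<and> set xs \<subseteq> carrier G \<and>
    (\<forall>T. T \<subseteq># mset xs \<longrightarrow> T \<noteq> {#} \<longrightarrow> \<one> \<notin> products G T)"
proof (induction n)
  case 0
  show ?case by simp
next
  case (Suc n)
  then obtain xs where xs: "length xs = n" "set xs \<subseteq> carrier G"
    "\<And>T. \<lbrakk>T \<subseteq># mset xs; T \<noteq> {#}\<rbrakk> \<Longrightarrow> \<one> \<notin> products G T"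
    by blast
  obtain g where "g \<in> carrier G" "\<And>T. \<lbrakk>T \<subseteq># mset (g # xs); T \<noteq> {#}\<rbrakk> \<Longrightarrow> \<one> \<notin> products G T"
    using product_one_free_extend[OF assms xs(2,3)] by blast
  with xs show ?case
    by (intro exI[of _ "g # xs"]) auto
qed

text \<open>A product-one free sequence of length \<open>n - 1\<close> is closed up by the inverse
  \<open>g\<close> of its product. In any splitting the factor without this occurrence of
  \<open>g\<close> lies in the free sequence, hence is empty.\<close>

lemma exists_atom_of_size:
  assumes "infinite (carrier G)" "n \<ge> 1"
  shows "\<exists>A\<in>atoms G. size A = n"
proof -
  obtain xs where xs: "length xs = n - 1" "set xs \<subseteq> carrier G"
    "\<And>T. \<lbrakk>T \<subseteq># mset xs; T \<noteq> {#}\<rbrakk> \<Longrightarrow> \<one> \<notin> products G T"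
    using exists_product_one_free[OF assms(1)] by blast
  define g where "g = inv (foldr (\<otimes>) xs \<one>)"
  let ?A = "add_mset g (mset xs)"
  have "g \<in> carrier G" "foldr (\<otimes>) (g # xs) \<one> = \<one>"
    using xs(2) by (simp_all add: g_def l_inv)
  then have "?A \<in> carrier (product_one_monoid G)"
    using xs(2) by (auto simp: one_in_products_iff intro!: exI[of _ "g # xs"])
  moreover have "C = {#}" if "?A = add_mset g B + C" "C \<in> carrier (product_one_monoid G)" for B C
    using that xs(3)[of C] by auto
  then have "B = {#} \<or> C = {#}" if "?A = B + C" "B \<in> carrier (product_one_monoid G)"
      "C \<in> carrier (product_one_monoid G)" for B C
    using that by (metis add.commute mset_add union_iff union_single_eq_member)
  ultimately have "?A \<in> atoms G"
    unfolding atoms_iff by (metis add_mset_not_empty)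
  then show ?thesis
    using xs(1) assms(2) by (intro bexI[of _ ?A]) auto
qed

text \<open>Inversion reverses products, so the reversed list of inverses witnesses product
  one.\<close>

lemma inv_image_in_carrier:
  assumes "A \<in> carrier (product_one_monoid G)"
  shows "image_mset (\<lambda>g. inv g) A \<in> carrier (product_one_monoid G)"
proof -
  obtain xs where xs: "mset xs = A" "foldr (\<otimes>) xs \<one> = \<one>"
    using assms by (auto simp: one_in_products_iff)
  have "foldr (\<otimes>) (map (\<lambda>g. inv g) (rev ys)) \<one> = inv (foldr (\<otimes>) ys \<one>)" if "set ys \<subseteq> carrier G" for ys
    using that
  proof (induction ys)
    case (Cons y ys)
    then have "set (map (\<lambda>g. inv g) (rev ys)) \<subseteq> carrier G" by auto
    then show ?case
      using Cons by (simp add: foldr_mult_append inv_mult_group del: foldr_append)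
  qed simp
  from this[of xs] xs assms have "foldr (\<otimes>) (map (\<lambda>g. inv g) (rev xs)) \<one> = \<one>"
    by auto
  then show ?thesis
    using xs assms by (auto simp: one_in_products_iff intro!: exI[of _ "map (\<lambda>g. inv g) (rev xs)"])
qed

lemma inv_inv_image:
  "set_mset A \<subseteq> carrier G \<Longrightarrow> image_mset (\<lambda>g. inv g) (image_mset (\<lambda>g. inv g) A) = A"
  by (induction A) auto

text \<open>Inversion is an involution on sequences, so a splitting of the image is carried back to
  a splitting of \<open>A\<close>.\<close>

lemma inv_image_atom:
  assumes "A \<in> atoms G"
  shows "image_mset (\<lambda>g. inv g) A \<in> atoms G"
proof -
  let ?i = "image_mset (\<lambda>g. inv g)"
  have "B = {#} \<or> C = {#}" if eq: "?i A = B + C" and B: "B \<in> carrier (product_one_monoid G)"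
    and C: "C \<in> carrier (product_one_monoid G)" for B C
  proof -
    have "A = ?i B + ?i C"
      using arg_cong[OF eq, of ?i] inv_inv_image[of A] atoms_carrier[OF assms] by simp
    then show ?thesis
      using atoms_plusD[of "?i B" "?i C"] assms inv_image_in_carrier[OF B] inv_image_in_carrier[OF C]
      by simp
  qed
  then show ?thesis
    using assms inv_image_in_carrier[OF atoms_carrier[OF assms]]
    by (simp add: atoms_iff[of "?i A"] atoms_nonempty del: product_one_monoid_simps)
qed

lemma inverse_pair_atom:
  assumes "g \<in> carrier G" "g \<noteq> \<one>"
  shows "{#g, inv g#} \<in> atoms G"
proof -
  have "\<one> \<in> products G {#g, inv g#}"
    unfolding one_in_products_iff using assms by (intro exI[of _ "[g, inv g]"]) (simp add: r_inv)
  then have "{#g, inv g#} \<in> carrier (product_one_monoid G)"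
    using assms(1) by auto
  moreover have single: "{#h#} \<notin> carrier (product_one_monoid G)" if "h \<in> {g, inv g}" for h
  proof
    assume "{#h#} \<in> carrier (product_one_monoid G)"
    then have "\<one> \<in> products G {#h#}" "h \<in> carrier G" by auto
    then have "h = \<one>"
      by (auto simp: one_in_products_iff)
    with that assms show False
      by (metis empty_iff insert_iff inv_eq_1_iff)
  qed
  have "B = {#} \<or> C = {#}" if "{#g, inv g#} = B + C" "B \<in> carrier (product_one_monoid G)"
      "C \<in> carrier (product_one_monoid G)" for B C
  proof (rule ccontr)
    assume "\<not> (B = {#} \<or> C = {#})"
    then have "0 < size B" "0 < size C"
      by (simp_all add: nonempty_has_size)
    moreover have "size B + size C = 2"
      using arg_cong[OF that(1), of size] by simp
    ultimately have "size B = 1"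
      by linarith
    then obtain h where "B = {#h#}"
      using size_1_singleton_mset by blast
    moreover have "h \<in> {g, inv g}"
      using arg_cong[OF that(1), of set_mset] \<open>B = {#h#}\<close> by auto
    ultimately show False
      using that(2) single by blast
  qed
  ultimately show ?thesis
    unfolding atoms_iff by (metis add_mset_not_empty)
qed

lemma union_of_lengths_two:
  assumes "infinite (carrier G)" "n \<ge> 2"
  shows "n \<in> union_of_lengths G 2"
proof -
  obtain A where A: "A \<in> atoms G" "size A = n"
    using exists_atom_of_size[OF assms(1), of n] assms(2) by auto
  have "\<one> \<notin># A"
    using atom_containing_one[OF A(1)] A(2) assms(2) by auto
  let ?V = "image_mset (\<lambda>g. {#g, inv g#}) A"
  have "set_mset ?V \<subseteq> atoms G"
    using inverse_pair_atom atoms_carrier[OF A(1)] \<open>\<one> \<notin># A\<close> by auto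
  moreover have "\<Sum>\<^sub># ?V = \<Sum>\<^sub># {#A, image_mset (\<lambda>g. inv g) A#}"
  proof -
    have "\<Sum>\<^sub># (image_mset (\<lambda>g. {#g, inv g#}) B) = B + image_mset (\<lambda>g. inv g) B" for B
      by (induction B) auto
    then show ?thesis by simp
  qed
  ultimately show ?thesis
    unfolding in_union_of_lengths_atoms_iff using A inv_image_atom[OF A(1)]
    by (intro exI[of _ "{#A, image_mset (\<lambda>g. inv g) A#}"] exI[of _ ?V]) auto
qed

lemma union_of_lengths_infinite:
  assumes "infinite (carrier G)" "k \<ge> 2"
  shows "union_of_lengths G k = {2..}"
proof
  show "union_of_lengths G k \<subseteq> {2..}"
  proof
    fix n assume "n \<in> union_of_lengths G k"
    then obtain a where a: "k \<in> lengths G a" "n \<in> lengths G a"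
      unfolding in_union_of_lengths_iff by blast
    have "n \<noteq> 0"
      using a assms(2) zero_in_lengths_iff[of G a] by (cases "n = 0") (auto simp: set_of_lengths_empty)
    moreover have "n \<noteq> 1"
    proof
      assume "n = 1"
      then have "lengths G a = {1}"
        using a(2) one_in_lengths_iff lengths_atom by blast
      with a(1) assms(2) show False by simp
    qed
    ultimately show "n \<in> {2..}" by simp
  qed
  have *: "n \<in> union_of_lengths G m" if "2 \<le> m" "m \<le> n" for m n
  proof -
    have "m - 2 + (n - m + 2) \<in> union_of_lengths G (m - 2 + 2)"
      using union_of_lengths_two[OF assms(1)] by (intro union_of_lengths_shift) simp
    moreover have "m - 2 + (n - m + 2) = n" "m - 2 + 2 = m"
      using that by auto
    ultimately show ?thesis by (simp only:)
  qed
  show "{2..} \<subseteq> union_of_lengths G k"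
    using * assms(2) union_of_lengths_commute by (metis atLeast_iff nat_le_linear subsetI)
qed

end

section \<open>Homomorphisms with sparse kernel\<close>

text \<open>\<open>\<phi>\<close> acts on integer vectors indexed by \<open>I\<close>; the entries of a kernel vector are only controlled
  if they are bounded by \<open>B\<close>, and for \<open>m = 0\<close> they then vanish.\<close>

definition sparse_hom :: "('a, 'b) monoid_scheme \<Rightarrow> 'i set \<Rightarrow> int \<Rightarrow> int \<Rightarrow> (('i \<Rightarrow> int) \<Rightarrow> 'a) \<Rightarrow> bool" where
  "sparse_hom G I B m \<phi> \<longleftrightarrow> (\<forall>c. \<phi> c \<in> carrier G) \<and>
    (\<forall>c d. \<phi> (\<lambda>i. c i + d i) = \<phi> c \<otimes>\<^bsub>G\<^esub> \<phi> d) \<and>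
    (\<forall>c. (\<forall>i\<in>I. c i = 0) \<longrightarrow> \<phi> c = \<one>\<^bsub>G\<^esub>) \<and>
    (\<forall>c. (\<forall>i\<in>I. \<bar>c i\<bar> \<le> B) \<longrightarrow> \<phi> c = \<one>\<^bsub>G\<^esub> \<longrightarrow> (\<forall>i\<in>I. m dvd c i))"

text \<open>As in a positional number system, the new weight \<open>N\<close> exceeds every value
  that bounded coefficients produce from the old weights, so its coefficient must vanish.\<close>

lemma exists_separating_weights:
  fixes B :: int
  assumes "finite I"
  shows "\<exists>w :: 'i \<Rightarrow> int. \<forall>c. (\<forall>i\<in>I. \<bar>c i\<bar> \<le> B) \<longrightarrow> (\<Sum>i\<in>I. c i * w i) = 0 \<longrightarrow> (\<forall>i\<in>I. c i = 0)"
  using assms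
proof (induction I)
  case (insert j I)
  then obtain w :: "'i \<Rightarrow> int" where w:
    "\<And>c. \<lbrakk>\<forall>i\<in>I. \<bar>c i\<bar> \<le> B; (\<Sum>i\<in>I. c i * w i) = 0\<rbrakk> \<Longrightarrow> \<forall>i\<in>I. c i = 0"
    by blast
  define N where "N = (\<Sum>i\<in>I. B * \<bar>w i\<bar>) + 1"
  have "\<forall>i\<in>insert j I. c i = 0"
    if c: "\<forall>i\<in>insert j I. \<bar>c i\<bar> \<le> B" "(\<Sum>i\<in>insert j I. c i * (w(j := N)) i) = 0" for c
  proof -
    have eq: "(\<Sum>i\<in>I. c i * (w(j := N)) i) = (\<Sum>i\<in>I. c i * w i)"
      using insert.hyps by (intro sum.cong) auto
    have sum: "c j * N + (\<Sum>i\<in>I. c i * w i) = 0"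
      using c(2) insert.hyps eq by simp
    have "\<bar>\<Sum>i\<in>I. c i * w i\<bar> \<le> (\<Sum>i\<in>I. \<bar>c i * w i\<bar>)"
      by (rule sum_abs)
    also have "\<dots> \<le> (\<Sum>i\<in>I. B * \<bar>w i\<bar>)"
      using c(1) by (intro sum_mono) (auto simp: abs_mult intro: mult_right_mono)
    finally have "\<bar>c j * N\<bar> < N"
      using sum by (simp add: N_def)
    moreover from this have "N > 0"
      using abs_ge_zero le_less_trans by blast
    ultimately have "\<bar>c j\<bar> * N < 1 * N"
      by (simp add: abs_mult)
    then have "c j = 0"
      using \<open>N > 0\<close> by (simp add: mult_less_cancel_right)
    then have "(\<Sum>i\<in>I. c i * w i) = 0"
      using sum by simp
    then have "\<forall>i\<in>I. c i = 0"
      using c(1) by (intro w) auto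
    with \<open>c j = 0\<close> show ?thesis by simp
  qed
  then show ?case by blast
qed simp

context group
begin

text \<open>All values are powers of one element \<open>g\<close>, the exponent being a weighted sum
  of the entries. Bounded vectors have exponents of absolute value at most \<open>N\<close>, and an
  order that is infinite or above \<open>N\<close> leaves only exponent 0 in the kernel.\<close>

lemma sparse_hom_of_large_order:
  fixes B :: int
  assumes I: "finite I" and large: "\<And>N. \<exists>g\<in>carrier G. ord g = 0 \<or> N < ord g"
  shows "\<exists>\<phi>. sparse_hom G (I :: 'i set) B 0 \<phi>"
proof -
  obtain w :: "'i \<Rightarrow> int" where w:
    "\<And>c. \<lbrakk>\<forall>i\<in>I. \<bar>c i\<bar> \<le> B; (\<Sum>i\<in>I. c i * w i) = 0\<rbrakk> \<Longrightarrow> \<forall>i\<in>I. c i = 0"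
    using exists_separating_weights[OF I] by blast
  define N where "N = (\<Sum>i\<in>I. B * \<bar>w i\<bar>)"
  obtain g where g: "g \<in> carrier G" "ord g = 0 \<or> nat N < ord g"
    using large by blast
  define \<phi> where "\<phi> c = g [^] (\<Sum>i\<in>I. c i * w i)" for c
  have "\<phi> (\<lambda>i. c i + d i) = \<phi> c \<otimes> \<phi> d" for c d
    using g(1) by (simp add: \<phi>_def distrib_right sum.distrib int_pow_mult)
  moreover have "\<phi> c = \<one>" if "\<forall>i\<in>I. c i = 0" for c
    using that by (simp add: \<phi>_def)
  moreover have "\<forall>i\<in>I. c i = 0" if c: "\<forall>i\<in>I. \<bar>c i\<bar> \<le> B" "\<phi> c = \<one>" for c
  proof -
    have dvd: "int (ord g) dvd (\<Sum>i\<in>I. c i * w i)"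
      using c(2) int_pow_eq_id[OF g(1)] by (simp add: \<phi>_def)
    have "\<bar>\<Sum>i\<in>I. c i * w i\<bar> \<le> (\<Sum>i\<in>I. \<bar>c i * w i\<bar>)"
      by (rule sum_abs)
    also have "\<dots> \<le> N"
      unfolding N_def using c(1) by (intro sum_mono) (auto simp: abs_mult intro: mult_right_mono)
    finally have "(\<Sum>i\<in>I. c i * w i) = 0"
      using dvd g(2) dvd_imp_le_int[of "\<Sum>i\<in>I. c i * w i" "int (ord g)"] by force
    then show ?thesis
      using w c(1) by blast
  qed
  ultimately have "sparse_hom G I B 0 \<phi>"
    unfolding sparse_hom_def using g(1) by (auto simp: \<phi>_def)
  then show ?thesis by blast
qed

end

context comm_group
begin

section \<open>Torsion and independence in abelian groups\<close>

definition torsion :: "nat \<Rightarrow> 'a set" where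
  "torsion n = {x \<in> carrier G. x [^] n = \<one>}"

text \<open>With \<open>n = p * k\<close>, the \<open>p\<close>-th power maps
  \<open>torsion n\<close> into \<open>torsion k\<close>, and each nonempty fibre embeds in
  \<open>torsion p\<close> through division by one of its elements. Used contrapositively: a large
  \<open>torsion n\<close> forces a large \<open>torsion p\<close> for some prime divisor
  \<open>p\<close>.\<close>

lemma torsion_card_le:
  assumes "q \<ge> 1" "n \<ge> 1"
    and "\<And>p. \<lbrakk>Factorial_Ring.prime p; p dvd n\<rbrakk> \<Longrightarrow> finite (torsion p) \<and> card (torsion p) \<le> q"
  shows "finite (torsion n) \<and> card (torsion n) \<le> q ^ n"
  using assms(2,3)
proof (induction n rule: less_induct)
  case (less n)
  show ?case
  proof (cases "n = 1")
    case True
    then have "torsion n = {\<one>}"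
      by (auto simp: torsion_def)
    then show ?thesis
      using assms(1) by simp
  next
    case False
    then obtain p k where p: "Factorial_Ring.prime p" "n = p * k"
      by (metis dvdE prime_factor_nat)
    have "k \<ge> 1" "k < n"
      using less.prems(1) p prime_gt_1_nat[of p] by (auto simp: Suc_le_eq)
    have fin: "finite (torsion p)" "card (torsion p) \<le> q"
      using less.prems(2) p by auto
    have IH: "finite (torsion k)" "card (torsion k) \<le> q ^ k"
      using less.IH[OF \<open>k < n\<close> \<open>k \<ge> 1\<close>] less.prems(2) p by auto
    let ?F = "\<lambda>y. {x \<in> torsion n. x [^] p = y}"
    have fibre: "finite (?F y) \<and> card (?F y) \<le> q" for y
    proof (cases "?F y = {}")
      case False
      then obtain x0 where x0: "x0 \<in> ?F y" by blast
      have "inj_on (\<lambda>x. x \<otimes> inv x0) (?F y)"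
        using x0 by (intro inj_onI) (auto simp: torsion_def)
      moreover have "(\<lambda>x. x \<otimes> inv x0) ` ?F y \<subseteq> torsion p"
        using x0 by (auto simp: torsion_def nat_pow_distrib nat_pow_inv r_inv)
      ultimately show ?thesis
        using fin by (meson card_inj_on_le inj_on_finite le_trans)
    next
      case True
      show ?thesis
        unfolding True by simp
    qed
    have "torsion n \<subseteq> (\<Union>y\<in>torsion k. ?F y)"
      by (auto simp: torsion_def nat_pow_pow p)
    moreover have "finite (\<Union>y\<in>torsion k. ?F y)" "card (\<Union>y\<in>torsion k. ?F y) \<le> card (torsion k) * q"
      using fibre IH(1) card_UN_le[OF IH(1), of ?F] sum_bounded_above[of "torsion k" "\<lambda>y. card (?F y)" q]
      by (auto intro: order_trans)
    ultimately have "finite (torsion n)" "card (torsion n) \<le> card (torsion k) * q"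
      by (auto intro: finite_subset order_trans[OF card_mono])
    moreover have "card (torsion k) * q \<le> q ^ Suc k"
      using IH(2) by simp
    moreover have "q ^ Suc k \<le> q ^ n"
      using \<open>k < n\<close> assms(1) by (intro power_increasing) auto
    ultimately show ?thesis
      by linarith
  qed
qed

lemma finprod_int_pow:
  assumes "finite I" "g \<in> I \<rightarrow> carrier G"
  shows "(\<Otimes>i\<in>I. g i [^] (c i :: int)) [^] (a :: int) = (\<Otimes>i\<in>I. g i [^] (c i * a))"
  using assms
proof (induction I)
  case (insert j I)
  then show ?case
    by (simp add: int_pow_distrib int_pow_pow Pi_iff)
qed simp

text \<open>\<open>torsion p\<close> is a vector space over the field with \<open>p\<close>
  elements. The span of \<open>card I\<close> vectors has at most \<open>p ^ card I\<close>
  elements, and a vector outside it extends the independent family.\<close>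

lemma exists_independent:
  assumes p: "Factorial_Ring.prime p" and I: "finite I"
    and large: "infinite (torsion p) \<or> p ^ card I < card (torsion p)"
  shows "\<exists>g. g \<in> I \<rightarrow> torsion p \<and>
    (\<forall>c :: 'i \<Rightarrow> int. (\<Otimes>i\<in>I. g i [^] c i) = \<one> \<longrightarrow> (\<forall>i\<in>I. int p dvd c i))"
  using I large
proof (induction I)
  case (insert j I)
  have "p ^ card I \<le> p ^ card (insert j I)"
    using p insert.hyps prime_ge_1_nat by (intro power_increasing) auto
  then have "infinite (torsion p) \<or> p ^ card I < card (torsion p)"
    using insert.prems by linarith
  then obtain g where g: "g \<in> I \<rightarrow> torsion p"
    "\<And>c :: 'i \<Rightarrow> int. (\<Otimes>i\<in>I. g i [^] c i) = \<one> \<Longrightarrow> \<forall>i\<in>I. int p dvd c i"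
    using insert.IH by blast
  have g_carrier: "g \<in> I \<rightarrow> carrier G"
    using g(1) by (auto simp: torsion_def)
  let ?prod = "\<lambda>c :: 'i \<Rightarrow> int. \<Otimes>i\<in>I. g i [^] c i"
  let ?S = "?prod ` (\<Pi>\<^sub>E i\<in>I. {0..<int p})"
  have pow_mod: "x [^] (a mod int p) = x [^] a" if "x \<in> torsion p" for x and a :: int
  proof -
    have x: "x \<in> carrier G" "x [^] int p = \<one>"
      using that by (auto simp: torsion_def int_pow_int)
    have "x [^] a = x [^] (int p * (a div int p) + a mod int p)"
      by simp
    also have "\<dots> = (x [^] int p) [^] (a div int p) \<otimes> x [^] (a mod int p)"
      by (simp only: int_pow_mult[OF x(1)] int_pow_pow[OF x(1)])
    also have "\<dots> = x [^] (a mod int p)"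
      using x by simp
    finally show ?thesis ..
  qed
  \<comment> \<open>Exponents matter only modulo \<open>p\<close>, so the finite set
    \<open>?S\<close> is the whole span of the previous elements.\<close>
  have span: "?prod c \<in> ?S" for c
  proof -
    have "?prod c = ?prod (\<lambda>i\<in>I. c i mod int p)"
      using g(1) pow_mod g_carrier by (intro finprod_cong') (simp_all add: Pi_iff)
    moreover have "(\<lambda>i\<in>I. c i mod int p) \<in> (\<Pi>\<^sub>E i\<in>I. {0..<int p})"
      using prime_gt_0_nat[OF p] by auto
    ultimately show ?thesis by blast
  qed
  have "finite (\<Pi>\<^sub>E i\<in>I. {0..<int p})" "card (\<Pi>\<^sub>E i\<in>I. {0..<int p}) = p ^ card I"
    using insert.hyps by (auto simp: card_PiE intro: finite_PiE)
  then have S: "finite ?S" "card ?S \<le> p ^ card I"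
    by (auto intro: order_trans[OF card_image_le])
  have "\<not> torsion p \<subseteq> ?S"
  proof
    assume "torsion p \<subseteq> ?S"
    then have "finite (torsion p)" "card (torsion p) \<le> p ^ card I"
      using S by (auto intro: finite_subset order_trans[OF card_mono])
    then show False
      using \<open>infinite (torsion p) \<or> p ^ card I < card (torsion p)\<close> by simp
  qed
  then obtain h where h: "h \<in> torsion p" "h \<notin> ?S" by blast
  then have h_carrier: "h \<in> carrier G"
    by (simp add: torsion_def)
  let ?g = "g(j := h)"
  have "\<forall>i\<in>insert j I. int p dvd c i" if c: "(\<Otimes>i\<in>insert j I. ?g i [^] c i) = \<one>" for c :: "'i \<Rightarrow> int"
  proof -
    have "(\<Otimes>i\<in>I. ?g i [^] c i) = ?prod c"
      using insert.hyps g_carrier by (intro finprod_cong') (auto simp: Pi_iff)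
    moreover have "(\<Otimes>i\<in>insert j I. ?g i [^] c i) = ?g j [^] c j \<otimes> (\<Otimes>i\<in>I. ?g i [^] c i)"
      using insert.hyps g_carrier h_carrier by (intro finprod_insert) (auto simp: Pi_iff)
    ultimately have eq: "h [^] c j \<otimes> ?prod c = \<one>"
      using c by simp
    have prod_carrier: "?prod c \<in> carrier G" for c
      using g_carrier by (intro finprod_closed) (auto simp: Pi_iff)
    have "int p dvd c j"
    proof (rule ccontr)
      assume "\<not> int p dvd c j"
      \<comment> \<open>An inverse \<open>a\<close> of \<open>c j\<close> modulo \<open>p\<close>
        would express \<open>h\<close> through the previous elements and put it into
        \<open>?S\<close>.\<close>
      then have "coprime (c j) (int p)"
        using p by (metis coprime_commute prime_imp_coprime prime_nat_int_transfer)
      then obtain a b where "a * c j + b * int p = 1"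
        using bezout_int[of "c j" "int p"] by auto
      then have "(c j * a) mod int p = 1 mod int p"
        by (metis mod_mult_self1 mult.commute)
      then have "h = (h [^] c j) [^] a"
        using pow_mod[OF h(1), of "c j * a"] pow_mod[OF h(1), of 1] h_carrier
        by (simp add: int_pow_pow)
      also have "h [^] c j = inv (?prod c)"
        using eq prod_carrier h_carrier by (metis int_pow_closed inv_equality)
      also have "inv (?prod c) [^] a = (?prod c) [^] (- a)"
        using prod_carrier by (simp add: int_pow_neg int_pow_inv)
      also have "\<dots> = ?prod (\<lambda>i. c i * (- a))"
        by (rule finprod_int_pow) (use insert.hyps g_carrier in auto)
      finally show False
        using span h(2) by metis
    qed
    moreover have "\<forall>i\<in>I. int p dvd c i"
    proof (rule g(2))
      have "h [^] c j = \<one>"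
        using pow_mod[OF h(1), of "c j"] \<open>int p dvd c j\<close> by simp
      then show "?prod c = \<one>"
        using eq prod_carrier by simp
    qed
    ultimately show ?thesis by simp
  qed
  moreover have "?g \<in> insert j I \<rightarrow> torsion p"
    using g(1) h(1) by auto
  ultimately show ?case by blast
qed simp

lemma sparse_hom_of_torsion:
  assumes p: "Factorial_Ring.prime p" and I: "finite I"
    and large: "infinite (torsion p) \<or> p ^ card I < card (torsion p)"
  shows "\<exists>\<phi>. sparse_hom G (I :: 'i set) B (int p) \<phi>"
proof -
  obtain g where g: "g \<in> I \<rightarrow> torsion p"
    "\<And>c :: 'i \<Rightarrow> int. (\<Otimes>i\<in>I. g i [^] c i) = \<one> \<Longrightarrow> \<forall>i\<in>I. int p dvd c i"
    using exists_independent[OF assms] by blast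
  have g_carrier: "g i \<in> carrier G" if "i \<in> I" for i
    using g(1) that by (auto simp: torsion_def)
  define \<phi> where "\<phi> c = (\<Otimes>i\<in>I. g i [^] c i)" for c :: "'i \<Rightarrow> int"
  have "\<phi> c \<in> carrier G" for c
    unfolding \<phi>_def using g_carrier by (intro finprod_closed) auto
  moreover have "\<phi> (\<lambda>i. c i + d i) = \<phi> c \<otimes> \<phi> d" for c d
  proof -
    have "\<phi> c \<otimes> \<phi> d = (\<Otimes>i\<in>I. g i [^] c i \<otimes> g i [^] d i)"
      unfolding \<phi>_def using g_carrier by (intro finprod_multf[symmetric]) auto
    also have "\<dots> = \<phi> (\<lambda>i. c i + d i)"
      unfolding \<phi>_def using g_carrier by (intro finprod_cong') (auto simp: int_pow_mult)
    finally show ?thesis ..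
  qed
  moreover have "\<phi> c = \<one>" if "\<forall>i\<in>I. c i = 0" for c
    unfolding \<phi>_def using that by (intro finprod_one_eqI) auto
  ultimately have "sparse_hom G I B (int p) \<phi>"
    unfolding sparse_hom_def using g(2) by (auto simp: \<phi>_def)
  then show ?thesis by blast
qed

end

text \<open>If element orders are unbounded or infinite, powers of a single element suffice, with
  \<open>m = 0\<close>. Otherwise all orders are at most \<open>N\<close>, so \<open>fact N\<close>
  annihilates every abelian subgroup, and a large one has large \<open>p\<close>-torsion for a prime
  \<open>p \<le> N\<close>; then \<open>m = p\<close>.\<close>

lemma (in group) exists_sparse_hom:
  assumes large: "has_infinite_order_element G \<or> unbounded_abelian_subgroups G"
    and I: "finite I"
  shows "\<exists>m \<phi>. \<not> m dvd 1 \<and> sparse_hom G (I :: 'i set) B m \<phi>"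
proof (cases "\<forall>N. \<exists>g\<in>carrier G. ord g = 0 \<or> N < ord g")
  case True
  then show ?thesis
    using sparse_hom_of_large_order[OF I] by (intro exI[of _ 0]) auto
next
  case False
  then obtain N where N: "\<And>g. g \<in> carrier G \<Longrightarrow> 0 < ord g \<and> ord g \<le> N"
    by (metis not_le not_gr_zero)
  have "N \<ge> 1"
    using N[OF one_closed] by linarith
  \<comment> \<open>This bounds \<open>p ^ card I\<close> for every prime divisor \<open>p\<close>
    of \<open>fact N\<close>, as the independence argument requires.\<close>
  define q where "q = N ^ card I"
  have "q \<ge> 1"
    using \<open>N \<ge> 1\<close> by (simp add: q_def)
  have "unbounded_abelian_subgroups G"
    using large N unfolding has_infinite_order_element_def by force
  then obtain H where H: "subgroup H G" "comm_group (G\<lparr>carrier := H\<rparr>)"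
    "infinite H \<or> q ^ fact N < card H"
    unfolding unbounded_abelian_subgroups_def by blast
  interpret K: comm_group "G\<lparr>carrier := H\<rparr>" by fact
  have "H \<subseteq> K.torsion (fact N)"
  proof
    fix x assume "x \<in> H"
    then have "x \<in> carrier G"
      using H(1) subgroup.mem_carrier by fast
    then have "x [^] (fact N :: nat) = \<one>"
      using N dvd_fact[of "ord x" N] pow_eq_id by (metis One_nat_def Suc_leI)
    with \<open>x \<in> H\<close> show "x \<in> K.torsion (fact N)"
      by (simp add: K.torsion_def nat_pow_consistent[symmetric])
  qed
  then have "\<not> (finite (K.torsion (fact N)) \<and> card (K.torsion (fact N)) \<le> q ^ fact N)"
    using H(3) by (meson card_mono finite_subset le_trans not_le)
  then obtain p where p: "Factorial_Ring.prime p" "p dvd fact N"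
    "infinite (K.torsion p) \<or> q < card (K.torsion p)"
    using K.torsion_card_le[of q "fact N"] \<open>q \<ge> 1\<close> by (metis fact_ge_1 not_le)
  have "p ^ card I \<le> q"
    unfolding q_def using p by (intro power_mono) (auto simp: prime_dvd_fact_iff)
  then obtain \<phi> where "sparse_hom (G\<lparr>carrier := H\<rparr>) I B (int p) \<phi>"
    using K.sparse_hom_of_torsion[OF p(1) I] p(3) by fastforce
  then have "sparse_hom G I B (int p) \<phi>"
    using subgroup.subset[OF H(1)] by (auto simp: sparse_hom_def)
  moreover have "\<not> int p dvd 1"
    using p(1) by (auto simp: zdvd1_eq)
  ultimately show ?thesis by blast
qed

section \<open>Additive subsets of a grid\<close>

text \<open>A length \<open>l\<close> serves both as the name of a coordinate and as the size of its range.\<close>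

definition grid :: "nat set \<Rightarrow> (nat \<Rightarrow> nat) set" where
  "grid L = (\<Pi>\<^sub>E l\<in>L. {..<l})"

definition grid_origin :: "nat set \<Rightarrow> nat \<Rightarrow> nat" where
  "grid_origin L = (\<lambda>l\<in>L. 0)"

text \<open>The defect of \<open>T\<close> vanishes on the grid if and only if the indicator function of \<open>T\<close> is a sum of
  functions of one coordinate each.\<close>

definition grid_defect :: "nat set \<Rightarrow> (nat \<Rightarrow> nat) set \<Rightarrow> (nat \<Rightarrow> nat) \<Rightarrow> int" where
  "grid_defect L T y = of_bool (y \<in> T) - of_bool (grid_origin L \<in> T) -
    (\<Sum>i\<in>L. of_bool ((grid_origin L)(i := y i) \<in> T) - of_bool (grid_origin L \<in> T))"

text \<open>The counterpart of an atom when \<open>Z\<close> stands for having product one.\<close>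

definition minimal_subset :: "('a set \<Rightarrow> bool) \<Rightarrow> 'a set \<Rightarrow> bool" where
  "minimal_subset Z T \<longleftrightarrow> T \<noteq> {} \<and> Z T \<and> (\<forall>U\<subseteq>T. U \<noteq> {} \<longrightarrow> Z U \<longrightarrow> U = T)"

text \<open>\<open>Z T\<close> models that the group elements attached to the points of
  \<open>T\<close> have product one. \<open>Z_dvd\<close> reflects the sparse kernel with modulus
  \<open>m\<close>, \<open>Z_zero\<close> that zero vectors map to the identity, and
  \<open>Z_Diff\<close> additivity.\<close>

locale additive_grid_subsets =
  fixes L :: "nat set" and m :: int and Z :: "(nat \<Rightarrow> nat) set \<Rightarrow> bool"
  assumes finite_L: "finite L" and L_ge_2: "L \<subseteq> {2..}" and two_in_L: "2 \<in> L"
    and not_unit: "\<not> m dvd 1"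
    and Z_dvd: "\<lbrakk>T \<subseteq> grid L; Z T; y \<in> grid L\<rbrakk> \<Longrightarrow> m dvd grid_defect L T y"
    and Z_zero: "\<lbrakk>T \<subseteq> grid L; \<And>y. y \<in> grid L \<Longrightarrow> grid_defect L T y = 0\<rbrakk> \<Longrightarrow> Z T"
    and Z_Diff: "\<lbrakk>T \<subseteq> grid L; U \<subseteq> T; Z T; Z U\<rbrakk> \<Longrightarrow> Z (T - U)"
begin

abbreviation "X \<equiv> grid L"
abbreviation "z \<equiv> grid_origin L"

definition slice :: "nat \<Rightarrow> nat \<Rightarrow> (nat \<Rightarrow> nat) set" where
  "slice i t = {y \<in> X. y i = t}"

text \<open>The indicator function of a mixed set depends on at least two coordinates.\<close>

definition mixed :: "(nat \<Rightarrow> nat) set \<Rightarrow> bool" where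
  "mixed T \<longleftrightarrow> (\<exists>i\<in>L. \<exists>j\<in>L. \<exists>t<i. \<exists>s<j. i \<noteq> j \<and>
    (z(i := t) \<in> T) \<noteq> (z \<in> T) \<and> (z(j := s) \<in> T) \<noteq> (z \<in> T))"

section \<open>Sets determined by one coordinate\<close>

lemma L_pos: "i \<in> L \<Longrightarrow> 0 < i"
  using L_ge_2 by force

lemma exists_other_coordinate:
  assumes "i \<in> L"
  shows "\<exists>s<i. s \<noteq> t"
  using L_ge_2 assms by (intro exI[of _ "if t = 0 then 1 else 0"]) auto

lemma z_in_X: "z \<in> X"
  using L_pos by (auto simp: grid_def grid_origin_def)

lemma upd_in_X: "\<lbrakk>y \<in> X; i \<in> L; t < i\<rbrakk> \<Longrightarrow> y(i := t) \<in> X"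
  by (auto simp: grid_def PiE_iff extensional_def)

lemma X_less: "\<lbrakk>y \<in> X; i \<in> L\<rbrakk> \<Longrightarrow> y i < i"
  by (auto simp: grid_def PiE_iff)

lemma z_eq [simp]: "i \<in> L \<Longrightarrow> z i = 0" "i \<in> L \<Longrightarrow> z(i := 0) = z"
  by (auto simp: grid_origin_def)

text \<open>The trace on the coordinate axes through the origin fixes every term of the defect at
  \<open>y\<close> except the indicator of \<open>y\<close>. So \<open>m\<close> divides a
  difference of two indicators, and a nonzero difference would make \<open>m\<close> a unit.\<close>

lemma eq_if_eq_on_axes:
  assumes "T \<subseteq> X" "U \<subseteq> X" "Z T" "Z U"
    and axes: "\<And>i t. \<lbrakk>i \<in> L; t < i\<rbrakk> \<Longrightarrow> z(i := t) \<in> T \<longleftrightarrow> z(i := t) \<in> U"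
  shows "T = U"
proof -
  have "y \<in> T \<longleftrightarrow> y \<in> U" if "y \<in> X" for y
  proof -
    have z: "z \<in> T \<longleftrightarrow> z \<in> U"
      using axes[OF two_in_L, of 0] two_in_L by simp
    have "grid_defect L T y - grid_defect L U y = of_bool (y \<in> T) - of_bool (y \<in> U)"
      unfolding grid_defect_def using axes z X_less[OF that] by simp
    then have "m dvd of_bool (y \<in> T) - of_bool (y \<in> U)"
      using Z_dvd[of T y] Z_dvd[of U y] assms that by (metis dvd_diff)
    then show ?thesis
      using not_unit by (auto split: if_splits simp: of_bool_def)
  qed
  with assms(1,2) show ?thesis by blast
qed

text \<open>An indicator depending on coordinate \<open>i\<close> alone has zero defect, since only
  the summand for \<open>i\<close> survives and it cancels the leading terms.\<close>

lemma Z_slices: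
  assumes "i \<in> L"
  shows "Z {y \<in> X. y i \<in> S}" (is "Z ?T")
proof (rule Z_zero)
  fix y assume y: "y \<in> X"
  have "(\<Sum>j\<in>L. of_bool (z(j := y j) \<in> ?T) - of_bool (z \<in> ?T)) =
      (\<Sum>j\<in>L. if j = i then of_bool (y i \<in> S) - of_bool (z \<in> ?T) else (0 :: int))"
    using y assms z_in_X X_less by (intro sum.cong) (auto intro: upd_in_X)
  also have "\<dots> = of_bool (y i \<in> S) - of_bool (z \<in> ?T)"
    using assms finite_L by simp
  finally show "grid_defect L ?T y = 0"
    using y by (simp add: grid_defect_def)
qed auto

lemma Z_slice: "i \<in> L \<Longrightarrow> Z (slice i t)"
  using Z_slices[of i "{t}"] by (simp add: slice_def)

lemma Z_X: "Z X"
  using Z_slices[OF two_in_L, of UNIV] by simp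

lemma Z_empty: "Z {}"
  using Z_slices[OF two_in_L, of "{}"] by simp

lemma Z_compl: "\<lbrakk>T \<subseteq> X; Z T\<rbrakk> \<Longrightarrow> Z (X - T)"
  using Z_Diff[of X T] Z_X by simp

text \<open>Membership is constant along all axes except possibly one, \<open>i\<close>. So
  \<open>T\<close> has the axis trace of a union of slices in direction \<open>i\<close>, and the
  trace determines it.\<close>

lemma unmixedD:
  assumes "T \<subseteq> X" "Z T" "\<not> mixed T"
  obtains i where "i \<in> L" "T = {y \<in> X. z(i := y i) \<in> T}"
proof -
  obtain i where i: "i \<in> L" "\<And>j t. \<lbrakk>j \<in> L; j \<noteq> i; t < j\<rbrakk> \<Longrightarrow> z(j := t) \<in> T \<longleftrightarrow> z \<in> T"
  proof (cases "\<forall>j\<in>L. \<forall>t<j. z(j := t) \<in> T \<longleftrightarrow> z \<in> T")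
    case True
    then show ?thesis
      using that two_in_L by blast
  next
    case False
    then show ?thesis
      using that assms(3) unfolding mixed_def by metis
  qed
  have "T = {y \<in> X. y i \<in> {t. z(i := t) \<in> T}}"
  proof (rule eq_if_eq_on_axes)
    fix j t assume "j \<in> L" "t < j"
    then show "z(j := t) \<in> T \<longleftrightarrow> z(j := t) \<in> {y \<in> X. y i \<in> {t. z(i := t) \<in> T}}"
      using i upd_in_X[OF z_in_X] by (cases "j = i") auto
  qed (use assms Z_slices[OF i(1), of "{t. z(i := t) \<in> T}"] in auto)
  with i(1) that show thesis by simp
qed

section \<open>Mixed sets\<close>

text \<open>At a point that differs from the origin in at most two coordinates, the defect is the
  second difference of the indicator function over a rectangle.\<close>

lemma grid_defect_corner:
  assumes "i \<in> L" "j \<in> L" "i \<noteq> j"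
  shows "grid_defect L T (z(i := t, j := s)) =
    of_bool (z(i := t, j := s) \<in> T) + of_bool (z \<in> T)
      - of_bool (z(i := t) \<in> T) - of_bool (z(j := s) \<in> T)"
proof -
  let ?f = "\<lambda>k. of_bool (z(k := (z(i := t, j := s)) k) \<in> T) - of_bool (z \<in> T) :: int"
  have "sum ?f L = sum ?f {i, j}"
    using assms finite_L by (intro sum.mono_neutral_right) auto
  also have "\<dots> = of_bool (z(i := t) \<in> T) + of_bool (z(j := s) \<in> T) - 2 * of_bool (z \<in> T)"
    using assms by simp
  finally show ?thesis
    by (simp add: grid_defect_def)
qed

lemma corner_dvd:
  assumes "T \<subseteq> X" "Z T" "i \<in> L" "j \<in> L" "i \<noteq> j" "t < i" "s < j"
  shows "m dvd of_bool (z(i := t, j := s) \<in> T) + of_bool (z \<in> T)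
      - of_bool (z(i := t) \<in> T) - of_bool (z(j := s) \<in> T)"
  using Z_dvd[OF assms(1,2), of "z(i := t, j := s)"] upd_in_X z_in_X assms
  by (simp add: grid_defect_corner)

text \<open>On a rectangle witnessing mixedness the second difference is 1 or 2 up to sign, and 1 is
  excluded because \<open>m\<close> is no unit.\<close>

lemma mixed_imp_dvd_2:
  assumes "T \<subseteq> X" "Z T" "mixed T"
  shows "m dvd 2"
proof -
  obtain i j t s where ij: "i \<in> L" "j \<in> L" "i \<noteq> j" "t < i" "s < j"
    "(z(i := t) \<in> T) \<noteq> (z \<in> T)" "(z(j := s) \<in> T) \<noteq> (z \<in> T)"
    using assms(3) unfolding mixed_def by blast
  show ?thesis
    using corner_dvd[OF assms(1,2) ij(1-5)] ij(6,7) not_unit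
    by (cases "z \<in> T"; cases "z(i := t, j := s) \<in> T") auto
qed

text \<open>For a mixed set the modulus is 2, and two nested sets of even parity on the corners of a
  two-dimensional rectangle agree there unless the smaller one avoids the corners altogether.\<close>

lemma mixed_subset_cases:
  assumes T: "T \<subseteq> X" "Z T" "mixed T" and U: "U \<subseteq> T" "Z U"
  shows "U = {} \<or> U = T"
proof -
  have "m dvd 2"
    using mixed_imp_dvd_2 T by blast
  then have "m = 2 \<or> m = -2"
    using not_unit dvd_imp_le_int[of 2 m] by (cases "m = 0") (auto dest: zdvd_imp_le simp: abs_le_iff)
  then have m: "m dvd a \<longleftrightarrow> even a" for a
    by auto
  have "U \<subseteq> X" using T(1) U(1) by blast
  have parity: "even (of_bool (z(i := t, j := s) \<in> W) + of_bool (z \<in> W)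
      - of_bool (z(i := t) \<in> W) - of_bool (z(j := s) \<in> W) :: int)"
    if "W \<in> {T, U}" "i \<in> L" "j \<in> L" "i \<noteq> j" "t < i" "s < j" for W i j t s
    using corner_dvd[of W i j t s] that T U \<open>U \<subseteq> X\<close> unfolding m by blast
  obtain i j t s where ij: "i \<in> L" "j \<in> L" "i \<noteq> j" "t < i" "s < j"
    "(z(i := t) \<in> T) \<noteq> (z \<in> T)" "(z(j := s) \<in> T) \<noteq> (z \<in> T)"
    using assms(3) unfolding mixed_def by blast
  \<comment> \<open>Exactly one of \<open>z(k := r)\<close> and \<open>z(i := t, k := r)\<close>
    lies in \<open>T\<close>, and the parity of \<open>U\<close> decides whether \<open>U\<close>
    contains that point, in agreement with \<open>W\<close>.\<close>
  have step: "(z(k := r) \<in> U \<longleftrightarrow> z(k := r) \<in> W)"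
    if "W \<in> {T, {}}" "z \<in> U \<longleftrightarrow> z \<in> W" "z(i := t) \<in> U \<longleftrightarrow> z(i := t) \<in> W"
      "(z(i := t) \<in> T) \<noteq> (z \<in> T)" "i \<in> L" "k \<in> L" "i \<noteq> k" "t < i" "r < k" for W i k t r
    using parity[of T i k t r] parity[of U i k t r] that U(1)
    by (cases "z \<in> T"; cases "z(k := r) \<in> T"; cases "z(k := r) \<in> U") (auto split: if_splits)
  \<comment> \<open>\<open>T\<close> meets the four corners in one diagonal. By parity
    \<open>U\<close> contains both points of this diagonal or neither, which selects
    \<open>W\<close>.\<close>
  have "\<exists>W\<in>{T, {}}. (z \<in> U \<longleftrightarrow> z \<in> W) \<and> (z(i := t) \<in> U \<longleftrightarrow> z(i := t) \<in> W) \<and>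
      (z(j := s) \<in> U \<longleftrightarrow> z(j := s) \<in> W)"
    using parity[of T i j t s] parity[of U i j t s] ij U(1)
    by (cases "z \<in> T"; cases "z \<in> U"; cases "z(i := t) \<in> U") (auto split: if_splits)
  then obtain W where W: "W \<in> {T, {}}" "z \<in> U \<longleftrightarrow> z \<in> W" "z(i := t) \<in> U \<longleftrightarrow> z(i := t) \<in> W"
      "z(j := s) \<in> U \<longleftrightarrow> z(j := s) \<in> W"
    by blast
  have "U = W"
  proof (rule eq_if_eq_on_axes)
    show "z(k := r) \<in> U \<longleftrightarrow> z(k := r) \<in> W" if "k \<in> L" "r < k" for k r
    \<comment> \<open>The axis \<open>i\<close> itself is reached from the axis
      \<open>j\<close>.\<close>
    proof (cases "k = i")
      case True
      then show ?thesis
        using step[of W j s k r] W ij that by blast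
    next
      case False
      then show ?thesis
        using step[of W i t k r] W ij that by blast
    qed
  qed (use W T U \<open>U \<subseteq> X\<close> Z_empty in auto)
  with W(1) show ?thesis by blast
qed

lemma mixed_minimal: "\<lbrakk>T \<subseteq> X; Z T; mixed T\<rbrakk> \<Longrightarrow> minimal_subset Z T"
  unfolding minimal_subset_def using mixed_subset_cases[of T] by (auto simp: mixed_def)

lemma mixed_compl: "mixed T \<Longrightarrow> mixed (X - T)"
  unfolding mixed_def using upd_in_X[OF z_in_X] z_in_X by blast

section \<open>Slices and partitions into minimal sets\<close>

lemma slice_subset: "slice i t \<subseteq> X"
  by (auto simp: slice_def)

lemma slice_point: "\<lbrakk>i \<in> L; t < i\<rbrakk> \<Longrightarrow> z(i := t) \<in> slice i t"
  by (simp add: slice_def upd_in_X z_in_X)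

text \<open>A nonempty unmixed set contains the slice through any of its points in the one direction
  on which it depends; minimality gives equality.\<close>

lemma minimal_cases:
  assumes "T \<subseteq> X" "minimal_subset Z T" "\<not> mixed T"
  obtains i t where "i \<in> L" "t < i" "T = slice i t"
proof -
  have T: "Z T" "T \<noteq> {}"
    using assms(2) by (auto simp: minimal_subset_def)
  obtain i where i: "i \<in> L" "T = {y \<in> X. z(i := y i) \<in> T}"
    using unmixedD assms T by blast
  obtain y where y: "y \<in> T"
    using T(2) by blast
  have T_iff: "x \<in> T \<longleftrightarrow> x \<in> X \<and> z(i := x i) \<in> T" for x
    using i(2) by blast
  have "z(i := y i) \<in> T"
    using T_iff y by blast
  then have "x \<in> T" if "x \<in> slice i (y i)" for x
    using that T_iff[of x] by (simp only: slice_def mem_Collect_eq)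
  moreover have "y \<in> slice i (y i)"
    using y assms(1) by (auto simp: slice_def)
  ultimately have "slice i (y i) \<subseteq> T" "y \<in> slice i (y i)"
    by blast+
  then have "slice i (y i) = T"
    using assms(2) Z_slice[OF i(1)] unfolding minimal_subset_def by blast
  then show thesis
    using that[of i "y i"] i(1) y assms(1) X_less by blast
qed

text \<open>If \<open>U\<close> is mixed, so is its complement, which contains the complement of the
  slice; \<open>mixed_subset_cases\<close> makes these complements equal, as the smaller one is
  nonempty by \<open>i \<ge> 2\<close>. If \<open>U\<close> is unmixed, it depends on one
  coordinate, and were this not \<open>i\<close>, changing coordinate \<open>i\<close> would leave
  the slice but not \<open>U\<close>.\<close>

lemma slice_minimal:
  assumes "i \<in> L" "t < i"
  shows "minimal_subset Z (slice i t)"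
proof -
  have "U = slice i t" if U: "U \<subseteq> slice i t" "U \<noteq> {}" "Z U" for U
  proof (cases "mixed U")
    case True
    have "U \<subseteq> X"
      using U(1) slice_subset by blast
    then have "X - slice i t = {} \<or> X - slice i t = X - U"
      using mixed_subset_cases[of "X - U" "X - slice i t"] True U mixed_compl Z_compl
        Z_slice[OF assms(1)] slice_subset \<open>U \<subseteq> X\<close> by auto
    moreover obtain s where "s < i" "s \<noteq> t"
      using exists_other_coordinate[OF assms(1)] by blast
    then have "z(i := s) \<in> X - slice i t"
      using assms(1) by (simp add: slice_def upd_in_X z_in_X)
    ultimately show ?thesis
      using \<open>U \<subseteq> X\<close> slice_subset by (metis double_diff empty_iff subset_refl)
  next
    case False
    have "U \<subseteq> X"
      using U(1) slice_subset by blast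
    then obtain j where j: "j \<in> L" "U = {y \<in> X. z(j := y j) \<in> U}"
      using unmixedD False U(3) by blast
    have U_iff: "x \<in> U \<longleftrightarrow> x \<in> X \<and> z(j := x j) \<in> U" for x
      using j(2) by blast
    obtain y where y: "y \<in> U" "y \<in> X" "y i = t"
      using U(1,2) by (auto simp: slice_def)
    have "j = i"
    proof (rule ccontr)
      assume "j \<noteq> i"
      obtain s where s: "s < i" "s \<noteq> t"
        using exists_other_coordinate[OF assms(1)] by blast
      then have "y(i := s) \<in> U"
        using U_iff[of y] U_iff[of "y(i := s)"] y(1) \<open>j \<noteq> i\<close> upd_in_X[OF y(2) assms(1)]
        by (metis fun_upd_other)
      with U(1) s show False
        by (auto simp: slice_def)
    qed
    then have "x \<in> U" if "x \<in> slice i t" for x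
      using that U_iff[of x] U_iff[of y] y by (simp only: slice_def mem_Collect_eq)
    then have "slice i t \<subseteq> U" by blast
    with U(1) show ?thesis by blast
  qed
  then show ?thesis
    unfolding minimal_subset_def using Z_slice[OF assms(1)] slice_point[OF assms] by blast
qed

lemma slices_partition:
  assumes "i \<in> L"
  shows "partition_on X (slice i ` {..<i})" "card (slice i ` {..<i}) = i"
proof -
  have "{} \<notin> slice i ` {..<i}"
    using slice_point[OF assms] by auto
  then show "partition_on X (slice i ` {..<i})"
    using assms X_less by (intro partition_onI) (auto simp: slice_def disjnt_def)
  have "inj_on (slice i) {..<i}"
  proof (rule inj_onI)
    fix t s assume "t \<in> {..<i}" "s \<in> {..<i}" "slice i t = slice i s"
    then have "z(i := t) \<in> slice i s"
      using slice_point[OF assms, of t] by auto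
    then show "t = s"
      by (simp add: slice_def)
  qed
  then show "card (slice i ` {..<i}) = i"
    by (simp add: card_image)
qed

text \<open>The complement of a mixed block is again minimal, which leaves only two blocks, and
  \<open>2 \<in> L\<close>. Otherwise all blocks are slices. Slices in different directions meet, so
  the blocks are the \<open>i\<close> slices in one direction \<open>i\<close>.\<close>

lemma card_minimal_partition:
  assumes P: "partition_on X P" and min: "\<And>T. T \<in> P \<Longrightarrow> minimal_subset Z T"
  shows "card P \<in> L"
proof -
  have sub: "T \<subseteq> X" if "T \<in> P" for T
    using P that by (auto simp: partition_on_def)
  have disj: "T = U" if "T \<in> P" "U \<in> P" "y \<in> T" "y \<in> U" for T U y
    using P that by (auto simp: partition_on_def disjoint_def)
  show ?thesis
  proof (cases "\<exists>T\<in>P. mixed T")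
    case True
    then obtain T where T: "T \<in> P" "mixed T" by blast
    have "Z T"
      using min[OF T(1)] by (simp add: minimal_subset_def)
    have compl: "minimal_subset Z (X - T)"
      using mixed_minimal[of "X - T"] mixed_compl[OF T(2)] Z_compl[of T] sub[OF T(1)] \<open>Z T\<close> by blast
    have other: "U = X - T" if "U \<in> P" "U \<noteq> T" for U
    proof -
      have "U \<subseteq> X - T"
        using disj[OF T(1) that(1)] sub that by blast
      then show ?thesis
        using compl min[OF that(1)] unfolding minimal_subset_def by blast
    qed
    moreover have "X - T \<in> P"
    proof -
      obtain y where "y \<in> X - T"
        using compl by (auto simp: minimal_subset_def)
      then obtain U where "U \<in> P" "y \<in> U"
        using P by (auto simp: partition_on_def)
      then show ?thesis
        using other \<open>y \<in> X - T\<close> by blast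
    qed
    ultimately have "P = {T, X - T}"
      using T(1) by blast
    moreover have "T \<noteq> X - T"
      using min[OF T(1)] by (auto simp: minimal_subset_def)
    ultimately show ?thesis
      using two_in_L by (metis card_2_iff)
  next
    case False
    then have slices: "\<exists>i\<in>L. \<exists>t<i. T = slice i t" if "T \<in> P" for T
      using minimal_cases[OF sub[OF that] min[OF that]] that by metis
    obtain T0 where "T0 \<in> P"
      using P z_in_X by (auto simp: partition_on_def)
    then obtain i t where it: "i \<in> L" "t < i" "slice i t \<in> P"
      using slices by metis
    have slices_i: "\<exists>s<i. T = slice i s" if T: "T \<in> P" for T
    proof -
      obtain j s where js: "j \<in> L" "s < j" "T = slice j s"
        using slices[OF T] by blast
      show ?thesis
      proof (cases "j = i")
        case False
        have "z(i := t, j := s) \<in> slice i t" "z(i := t, j := s) \<in> slice j s"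
          using it js False by (auto simp: slice_def upd_in_X z_in_X)
        then show ?thesis
          using disj[OF T it(3)] js it(2) by blast
      qed (use js in blast)
    qed
    have "P = slice i ` {..<i}"
    proof
      show "P \<subseteq> slice i ` {..<i}"
        using slices_i by blast
      show "slice i ` {..<i} \<subseteq> P"
      proof safe
        fix s assume "s < i"
        then have "z(i := s) \<in> X"
          using it(1) by (simp add: upd_in_X z_in_X)
        then obtain T where T: "T \<in> P" "z(i := s) \<in> T"
          using P by (auto simp: partition_on_def)
        then obtain r where "T = slice i r"
          using slices_i by blast
        with T show "slice i s \<in> P"
          by (simp add: slice_def)
      qed
    qed
    then show ?thesis
      using slices_partition(2)[OF it(1)] it(1) by simp
  qed
qed

lemma minimal_partition_cards:
  "{card P |P. partition_on X P \<and> (\<forall>T\<in>P. minimal_subset Z T)} = L"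
proof safe
  fix i assume "i \<in> L"
  then show "\<exists>P. i = card P \<and> partition_on X P \<and> (\<forall>T\<in>P. minimal_subset Z T)"
    using slices_partition slice_minimal by (intro exI[of _ "slice i ` {..<i}"]) auto
qed (use card_minimal_partition in blast)

end

section \<open>Realizing sets of lengths\<close>

text \<open>\<open>w\<close> may repeat values, so a subsequence does not determine its index set;
  it is enough that some splitting of \<open>T\<close> induces the given one.\<close>

lemma image_mset_set_eq_plusD:
  assumes "finite T" "image_mset w (mset_set T) = B + C"
  shows "\<exists>U\<subseteq>T. B = image_mset w (mset_set U) \<and> C = image_mset w (mset_set (T - U))"
proof -
  obtain B' C' where BC: "mset_set T = B' + C'" "B = image_mset w B'" "C = image_mset w C'"
    using image_mset_eq_plusD[OF assms(2)] by blast
  have U: "set_mset B' \<subseteq> T"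
    using arg_cong[OF BC(1), of set_mset] assms(1) by auto
  \<comment> \<open>A submultiset of \<open>mset_set T\<close> has multiplicities at most one, hence
    comes from a set.\<close>
  have "B' = mset_set (set_mset B')"
  proof (rule multiset_eqI)
    fix x
    have "count B' x \<le> 1"
      using arg_cong[OF BC(1), of "\<lambda>M. count M x"] by (simp add: count_mset_set' split: if_splits)
    then show "count B' x = count (mset_set (set_mset B')) x"
      by (cases "x \<in># B'") (auto simp: count_mset_set' not_in_iff simp flip: count_greater_zero_iff)
  qed
  moreover from this have "C' = mset_set (T - set_mset B')"
    using BC(1) mset_set_Diff[OF assms(1) U] by (metis add_diff_cancel_left')
  ultimately show ?thesis
    using BC(2,3) U by metis
qed

lemma factorization_imp_partition:
  assumes "finite T" "\<Sum>\<^sub># F = image_mset w (mset_set T)" "{#} \<notin># F"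
  shows "\<exists>P. partition_on T P \<and> image_mset (\<lambda>U. image_mset w (mset_set U)) (mset_set P) = F"
  using assms
proof (induction F arbitrary: T)
  case empty
  then have "T = {}"
    by (simp add: mset_set_empty_iff)
  then show ?case
    by (intro exI[of _ "{}"]) (simp add: partition_on_def)
next
  case (add A F)
  obtain U where U: "U \<subseteq> T" "A = image_mset w (mset_set U)"
    "\<Sum>\<^sub># F = image_mset w (mset_set (T - U))"
    using image_mset_set_eq_plusD[OF add.prems(1), of w A "\<Sum>\<^sub># F"] add.prems(2) by auto
  obtain P where P: "partition_on (T - U) P"
    "image_mset (\<lambda>U. image_mset w (mset_set U)) (mset_set P) = F"
    using add.IH[OF _ U(3)] add.prems by auto
  have "U \<noteq> {}"
    using add.prems(3) U(2) by auto
  have "finite P"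
    using P(1) add.prems(1) finite_elements by blast
  \<comment> \<open>Different blocks may carry equal sequences; since \<open>U\<close> is a new
    block, inserting it adds exactly one copy of \<open>A\<close>.\<close>
  have "U \<notin> P"
    using P(1) \<open>U \<noteq> {}\<close> by (auto simp: partition_on_def)
  have "partition_on T (insert U P)"
    using P(1) U(1) \<open>U \<noteq> {}\<close> by (auto simp: partition_on_def disjoint_def)
  with P(2) U(2) \<open>U \<notin> P\<close> \<open>finite P\<close> show ?case
    by (intro exI[of _ "insert U P"]) simp
qed

lemma sum_mset_partition:
  assumes "finite P" "disjoint P" "\<And>T. T \<in> P \<Longrightarrow> finite T"
  shows "\<Sum>\<^sub># (image_mset (\<lambda>U. image_mset w (mset_set U)) (mset_set P)) = image_mset w (mset_set (\<Union>P))"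
  using assms
proof (induction P)
  case (insert U P)
  have "U \<inter> \<Union>P = {}"
    using insert.prems(1) insert.hyps(2) by (auto simp: disjoint_def)
  then have "mset_set (\<Union>(insert U P)) = mset_set U + mset_set (\<Union>P)"
    using insert.prems insert.hyps by (simp add: mset_set_Union)
  moreover have "disjoint P"
    using insert.prems(1) by (auto simp: disjoint_def)
  ultimately show ?case
    using insert by simp
qed simp

text \<open>Splittings lift to the index set, so atoms correspond to minimal subsets and
  factorizations to partitions into them. \<open>Z_Diff\<close> supplies the second factor when a
  subset with product one is split off.\<close>

lemma lengths_eq_minimal_partitions:
  fixes w :: "'x \<Rightarrow> 'a" and G :: "('a, 'b) monoid_scheme" and Z :: "'x set \<Rightarrow> bool"
  assumes X: "finite X" "w ` X \<subseteq> carrier G"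
    and Z: "\<And>T. T \<subseteq> X \<Longrightarrow> \<one>\<^bsub>G\<^esub> \<in> products G (image_mset w (mset_set T)) \<longleftrightarrow> Z T"
    and Z_Diff: "\<And>T U. \<lbrakk>T \<subseteq> X; U \<subseteq> T; Z T; Z U\<rbrakk> \<Longrightarrow> Z (T - U)"
  shows "lengths G (image_mset w (mset_set X)) =
    {card P |P. partition_on X P \<and> (\<forall>T\<in>P. minimal_subset Z T)}"
proof -
  let ?seq = "\<lambda>T. image_mset w (mset_set T)"
  have fin: "finite T" if "T \<subseteq> X" for T
    using that X(1) finite_subset by blast
  have carrier_iff: "?seq T \<in> carrier (product_one_monoid G) \<longleftrightarrow> Z T" if "T \<subseteq> X" for T
    using that X Z fin[OF that] by auto
  have empty_iff: "?seq T = {#} \<longleftrightarrow> T = {}" if "T \<subseteq> X" for T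
    using fin[OF that] by (simp add: mset_set_empty_iff)
  have atom_iff: "?seq T \<in> atoms G \<longleftrightarrow> minimal_subset Z T" if T: "T \<subseteq> X" for T
  proof
    assume atom: "?seq T \<in> atoms G"
    then have "Z T" "T \<noteq> {}"
      using carrier_iff[OF T] atoms_carrier[OF atom] atoms_nonempty[OF atom] by auto
    moreover have "U = T" if U: "U \<subseteq> T" "U \<noteq> {}" "Z U" for U
    proof -
      have "?seq T = ?seq U + ?seq (T - U)"
        using U(1) fin[OF T]
        by (metis Diff_disjoint Diff_partition finite_Diff finite_subset image_mset_union mset_set_Union)
      moreover have "Z (T - U)"
        using Z_Diff T U \<open>Z T\<close> by blast
      ultimately have "?seq U = {#} \<or> ?seq (T - U) = {#}"
        using atom T U carrier_iff[of U] carrier_iff[of "T - U"]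
        by (intro atoms_plusD) (auto simp del: product_one_monoid_simps)
      then show ?thesis
        using empty_iff[of U] empty_iff[of "T - U"] T U by blast
    qed
    ultimately show "minimal_subset Z T"
      by (auto simp: minimal_subset_def)
  next
    assume min: "minimal_subset Z T"
    have "B = {#} \<or> C = {#}" if eq: "?seq T = B + C" and B: "B \<in> carrier (product_one_monoid G)" for B C
    proof -
      obtain U where U: "U \<subseteq> T" "B = ?seq U" "C = ?seq (T - U)"
        using image_mset_set_eq_plusD[OF fin[OF T] eq] by blast
      then have "Z U"
        using B carrier_iff[of U] T by blast
      then have "U = {} \<or> U = T"
        using min U(1) by (auto simp: minimal_subset_def)
      then show ?thesis
        using U by auto
    qed
    moreover have "?seq T \<in> carrier (product_one_monoid G)" "?seq T \<noteq> {#}"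
      using min carrier_iff[OF T] empty_iff[OF T] by (auto simp: minimal_subset_def)
    ultimately show "?seq T \<in> atoms G"
      unfolding atoms_iff by blast
  qed
  show ?thesis
  proof (intro equalityI subsetI)
    fix n assume "n \<in> lengths G (?seq X)"
    then obtain F where F: "set_mset F \<subseteq> atoms G" "\<Sum>\<^sub># F = ?seq X" "size F = n"
      by (elim in_lengthsE)
    then obtain P where P: "partition_on X P" "image_mset ?seq (mset_set P) = F"
      using factorization_imp_partition[OF X(1) F(2)] by (auto dest: atoms_nonempty)
    have "finite P"
      using P(1) X(1) finite_elements by blast
    have "T \<subseteq> X" "?seq T \<in> atoms G" if "T \<in> P" for T
      using that P(1) F(1) \<open>finite P\<close> by (auto simp: partition_on_def simp flip: P(2))
    then have "\<forall>T\<in>P. minimal_subset Z T"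
      using atom_iff by blast
    moreover have "card P = n"
      using F(3) P(2) by auto
    ultimately show "n \<in> {card P |P. partition_on X P \<and> (\<forall>T\<in>P. minimal_subset Z T)}"
      using P(1) by blast
  next
    fix n assume "n \<in> {card P |P. partition_on X P \<and> (\<forall>T\<in>P. minimal_subset Z T)}"
    then obtain P where P: "partition_on X P" "\<And>T. T \<in> P \<Longrightarrow> minimal_subset Z T" "n = card P"
      by blast
    have "finite P"
      using P(1) X(1) finite_elements by blast
    have sub: "T \<subseteq> X" if "T \<in> P" for T
      using that P(1) by (auto simp: partition_on_def)
    have "\<Sum>\<^sub># (image_mset ?seq (mset_set P)) = ?seq X"
      using sum_mset_partition[OF \<open>finite P\<close>] P(1) fin[OF sub] by (auto simp: partition_on_def)
    then show "n \<in> lengths G (?seq X)"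
      using P sub atom_iff \<open>finite P\<close>
      by (intro in_lengthsI[of "image_mset ?seq (mset_set P)"]) auto
  qed
qed

section \<open>Sequences built from a sparse homomorphism\<close>

lemma mset_eq_image_mset:
  "mset ys = image_mset f M \<Longrightarrow> \<exists>xs. mset xs = M \<and> map f xs = ys"
proof (induction ys arbitrary: M)
  case (Cons y ys)
  then obtain N x where "M = add_mset x N" "f x = y" "image_mset f N = mset ys"
    using msed_map_invR[of f M y "mset ys"] by auto
  with Cons.IH[of N] show ?case
    by (metis list.simps(9) mset.simps(2))
qed simp

lemma foldr_sparse_hom:
  assumes "sparse_hom G I B m \<phi>"
  shows "foldr (\<otimes>\<^bsub>G\<^esub>) (map (\<lambda>x. \<phi> (v x)) xs) \<one>\<^bsub>G\<^esub> = \<phi> (\<lambda>i. \<Sum>x\<leftarrow>xs. v x i)"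
  using assms by (induction xs) (simp_all add: sparse_hom_def)

text \<open>Additivity makes the values of \<open>\<phi>\<close> commute, so all orderings have the
  same product even if \<open>G\<close> is not abelian.\<close>

lemma one_in_products_sparse_hom:
  assumes "sparse_hom G I B m \<phi>" "finite T"
  shows "\<one>\<^bsub>G\<^esub> \<in> products G (image_mset (\<lambda>x. \<phi> (v x)) (mset_set T)) \<longleftrightarrow>
    \<phi> (\<lambda>i. \<Sum>x\<in>T. v x i) = \<one>\<^bsub>G\<^esub>"
proof -
  have *: "foldr (\<otimes>\<^bsub>G\<^esub>) (map (\<lambda>x. \<phi> (v x)) xs) \<one>\<^bsub>G\<^esub> = \<phi> (\<lambda>i. \<Sum>x\<in>T. v x i)"
    if "mset xs = mset_set T" for xs
    unfolding foldr_sparse_hom[OF assms(1)] sum_unfold_sum_mset that[symmetric]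
    by (simp add: sum_mset_sum_list flip: mset_map)
  show ?thesis
  proof
    assume "\<one>\<^bsub>G\<^esub> \<in> products G (image_mset (\<lambda>x. \<phi> (v x)) (mset_set T))"
    then obtain ys where "mset ys = image_mset (\<lambda>x. \<phi> (v x)) (mset_set T)"
      and ys: "foldr (\<otimes>\<^bsub>G\<^esub>) ys \<one>\<^bsub>G\<^esub> = \<one>\<^bsub>G\<^esub>"
      unfolding one_in_products_iff by blast
    then obtain xs where "mset xs = mset_set T" "map (\<lambda>x. \<phi> (v x)) xs = ys"
      using mset_eq_image_mset by blast
    with *[of xs] ys show "\<phi> (\<lambda>i. \<Sum>x\<in>T. v x i) = \<one>\<^bsub>G\<^esub>"
      by simp
  next
    assume "\<phi> (\<lambda>i. \<Sum>x\<in>T. v x i) = \<one>\<^bsub>G\<^esub>"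
    moreover obtain xs where "mset xs = mset_set T"
      using ex_mset by blast
    ultimately show "\<one>\<^bsub>G\<^esub> \<in> products G (image_mset (\<lambda>x. \<phi> (v x)) (mset_set T))"
      unfolding one_in_products_iff using *[of xs]
      by (intro exI[of _ "map (\<lambda>x. \<phi> (v x)) xs"]) simp
  qed
qed

text \<open>The defect is linear in the indicator function; this turns products of attached elements
  into values of the homomorphism at defects.\<close>

lemma grid_defect_sum:
  assumes "finite T"
  shows "grid_defect L T y = (\<Sum>x\<in>T. grid_defect L {x} y)"
proof -
  have *: "(\<Sum>x\<in>T. of_bool (a = x)) = (of_bool (a \<in> T) :: int)" for a
    using assms by (simp add: of_bool_def)
  show ?thesis
    unfolding grid_defect_def sum_subtractf by (subst sum.swap) (simp add: * flip: sum_distrib_left)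
qed

text \<open>Provides the entry bound under which \<open>sparse_hom\<close> controls the
  kernel.\<close>

lemma grid_defect_abs_le:
  "\<bar>grid_defect L T y\<bar> \<le> 1 + int (card L)"
proof -
  have "\<bar>\<Sum>i\<in>L. of_bool ((grid_origin L)(i := y i) \<in> T) - of_bool (grid_origin L \<in> T)\<bar> \<le> (\<Sum>i\<in>L. 1 :: int)"
    by (rule order_trans[OF sum_abs sum_mono]) auto
  then show ?thesis
    by (auto simp: grid_defect_def of_bool_def split: if_splits)
qed

context group
begin

text \<open>The point \<open>x\<close> receives \<open>\<phi> (grid_defect L {x})\<close>, so the
  elements over \<open>T\<close> multiply to \<open>\<phi> (grid_defect L T)\<close>. Slices have
  zero defect and hence product one, while the sparse kernel admits only sets whose defect vanishes
  modulo \<open>m\<close> on the grid.\<close>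

lemma exists_lengths_eq_of_two_mem:
  assumes large: "has_infinite_order_element G \<or> unbounded_abelian_subgroups G"
    and L: "finite L" "L \<subseteq> {2..}" "2 \<in> L"
  shows "\<exists>a\<in>carrier (product_one_monoid G). lengths G a = L"
proof -
  have X: "finite (grid L)"
    unfolding grid_def using L(1) by (intro finite_PiE) auto
  obtain m \<phi> where m: "\<not> m dvd 1" and \<phi>: "sparse_hom G (grid L) (1 + int (card L)) m \<phi>"
    using exists_sparse_hom[OF large X] by blast
  define Z where "Z T \<longleftrightarrow> \<phi> (grid_defect L T) = \<one>" for T
  define w where "w x = \<phi> (grid_defect L {x})" for x
  have fin: "finite T" if "T \<subseteq> grid L" for T
    using that X finite_subset by blast
  have Z: "\<one> \<in> products G (image_mset w (mset_set T)) \<longleftrightarrow> Z T" if "T \<subseteq> grid L" for T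
  proof -
    have "(\<lambda>y. \<Sum>x\<in>T. grid_defect L {x} y) = grid_defect L T"
      by (rule ext) (rule grid_defect_sum[OF fin[OF that], symmetric])
    then show ?thesis
      unfolding w_def one_in_products_sparse_hom[OF \<phi> fin[OF that]] Z_def by (simp only:)
  qed
  have \<phi>_closed: "\<phi> c \<in> carrier G" for c
    using \<phi> by (simp add: sparse_hom_def)
  interpret additive_grid_subsets L m Z
  proof
    show "Z (T - U)" if T: "T \<subseteq> grid L" "U \<subseteq> T" "Z T" "Z U" for T U
    proof -
      have "grid_defect L T y = grid_defect L U y + grid_defect L (T - U) y" for y
        using sum.subset_diff[OF T(2) fin[OF T(1)], of "\<lambda>x. grid_defect L {x} y"]
          grid_defect_sum[of T L y] grid_defect_sum[of U L y] grid_defect_sum[of "T - U" L y]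
          fin[OF T(1)] finite_subset[OF T(2)] by simp
      then have "grid_defect L T = (\<lambda>y. grid_defect L U y + grid_defect L (T - U) y)"
        by blast
      then have "\<phi> (grid_defect L T) = \<phi> (grid_defect L U) \<otimes> \<phi> (grid_defect L (T - U))"
        using \<phi> by (simp add: sparse_hom_def)
      then show ?thesis
        using T \<phi>_closed by (simp add: Z_def)
    qed
  next
    show "m dvd grid_defect L T y" if "T \<subseteq> grid L" "Z T" "y \<in> grid L" for T y
      using \<phi> that grid_defect_abs_le by (auto simp: sparse_hom_def Z_def)
  next
    show "Z T" if "T \<subseteq> grid L" "\<And>y. y \<in> grid L \<Longrightarrow> grid_defect L T y = 0" for T
      using \<phi> that by (auto simp: sparse_hom_def Z_def)
  qed (use L m in auto)
  let ?a = "image_mset w (mset_set (grid L))"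
  have "w ` grid L \<subseteq> carrier G"
    using \<phi>_closed by (auto simp: w_def)
  then have "lengths G ?a = L"
    using lengths_eq_minimal_partitions[OF X _ Z Z_Diff] minimal_partition_cards by simp
  moreover have "?a \<in> carrier (product_one_monoid G)"
    using Z[of "grid L"] Z_X X \<open>w ` grid L \<subseteq> carrier G\<close> by auto
  ultimately show ?thesis by blast
qed

lemma exists_lengths_eq:
  assumes large: "has_infinite_order_element G \<or> unbounded_abelian_subgroups G"
    and L: "finite L" "L \<subseteq> {2..}" "L \<noteq> {}"
  shows "\<exists>a\<in>carrier (product_one_monoid G). lengths G a = L"
proof -
  \<comment> \<open>The shift by \<open>d\<close> moves the minimum to 2, the coordinate that the
    grid argument needs; the subtraction is exact because \<open>2 \<le> Min L\<close>.\<close>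
  define d where "d = Min L - 2"
  have "2 \<le> Min L"
    using Min_in[OF L(1,3)] L(2) by auto
  then have d: "d + 2 = Min L" "\<And>l. l \<in> L \<Longrightarrow> d + 2 \<le> l"
    using Min_le[OF L(1)] by (fastforce simp: d_def)+
  let ?K = "(\<lambda>l. l - d) ` L"
  have "2 \<in> ?K"
    using d(1) Min_in[OF L(1,3)] by (intro image_eqI[of _ _ "d + 2"]) auto
  moreover have "?K \<subseteq> {2..}"
    using d(2) by force
  ultimately obtain a where a: "a \<in> carrier (product_one_monoid G)" "lengths G a = ?K"
    using exists_lengths_eq_of_two_mem[OF large, of ?K] L(1) by blast
  have "lengths G (replicate_mset d \<one> + a) = L"
    unfolding lengths_add_ones a(2) image_image using d(2) by (force simp: image_iff)
  moreover have "replicate_mset d \<one> + a \<in> carrier (product_one_monoid G)"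
    using replicate_one_in_carrier[of d] a(1) one_in_products_add by auto
  ultimately show ?thesis by blast
qed

section \<open>The full system of sets of lengths\<close>

text \<open>Length 0 occurs only for the empty sequence and length 1 only for atoms, and each of
  these has a single length; all other sets of lengths start at 2 or later.\<close>

lemma system_of_lengths_full:
  assumes large: "has_infinite_order_element G \<or> unbounded_abelian_subgroups G"
  shows "system_of_lengths G = {L. L \<subseteq> {2..} \<and> finite L \<and> L \<noteq> {}} \<union> {{0}, {1}}"
proof (intro equalityI subsetI)
  fix L assume "L \<in> system_of_lengths G"
  then obtain a where a: "a \<in> carrier (product_one_monoid G)" "L = lengths G a"
    unfolding system_of_lengths_def by blast
  show "L \<in> {L. L \<subseteq> {2..} \<and> finite L \<and> L \<noteq> {}} \<union> {{0}, {1}}"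
  proof (cases "a = {#} \<or> a \<in> atoms G")
    case True
    then show ?thesis
      using a(2) by (auto simp: set_of_lengths_empty lengths_atom)
  next
    case False
    then have "0 \<notin> L" "1 \<notin> L"
      using a(2) zero_in_lengths_iff one_in_lengths_iff by blast+
    then have "n \<ge> 2" if "n \<in> L" for n
      using that by (cases "n = 0"; cases "n = 1") auto
    then show ?thesis
      using finite_lengths lengths_nonempty a by blast
  qed
next
  fix L assume "L \<in> {L. L \<subseteq> {2..} \<and> finite L \<and> L \<noteq> {}} \<union> {{0}, {1::nat}}"
  then consider "L \<subseteq> {2..}" "finite L" "L \<noteq> {}" | "L = {0}" | "L = {1}"
    by blast
  then have "\<exists>a\<in>carrier (product_one_monoid G). lengths G a = L"
  proof cases
    case 1
    then show ?thesis
      using exists_lengths_eq[OF large] by blast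
  next
    case 2
    then show ?thesis
      using set_of_lengths_empty[of G] by (intro bexI[of _ "{#}"]) auto
  next
    case 3
    then show ?thesis
      using lengths_atom[OF singleton_one_atom] atoms_carrier[OF singleton_one_atom] by blast
  qed
  then show "L \<in> system_of_lengths G"
    unfolding system_of_lengths_def by blast
qed

lemma set_of_distances_full:
  assumes large: "has_infinite_order_element G \<or> unbounded_abelian_subgroups G"
  shows "set_of_distances G = {1..}"
proof
  show "set_of_distances G \<subseteq> {1..}"
    by (auto simp: set_of_distances_def distances_def)
  show "{1..} \<subseteq> set_of_distances G"
  proof
    fix d :: nat assume "d \<in> {1..}"
    then have "d \<in> distances {2, 2 + d}"
      by (auto simp: distances_def)
    moreover have "{2, 2 + d} \<in> system_of_lengths G"
      unfolding system_of_lengths_full[OF large] by auto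
    ultimately show "d \<in> set_of_distances G"
      unfolding set_of_distances_def by blast
  qed
qed

end

theorem theorem4p4:
  fixes G :: "('a, 'b) monoid_scheme"
  assumes "group G"
  shows "(\<forall>k\<ge>2.
            union_of_lengths G k =
              {n. lower_elasticity G k \<le> n \<and> enat n \<le> upper_elasticity G k} \<and>
            (infinite (carrier G) \<longrightarrow> union_of_lengths G k = {2..})) \<and>
         (has_infinite_order_element G \<or> unbounded_abelian_subgroups G \<longrightarrow>
            system_of_lengths G = {L. L \<subseteq> {2..} \<and> finite L \<and> L \<noteq> {}} \<union> {{0}, {1}} \<and>
            set_of_distances G = {1..})"
proof -
  interpret group G by fact
  show ?thesis
    by (intro conjI allI impI union_of_lengths_interval union_of_lengths_infinite
        system_of_lengths_full set_of_distances_full)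
qed

end
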